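(* Let $n>1$ be an integer and, for $z\in\mathbb{Z}/(n)$, let $p_z$ be primes with $p_z\ne p_{z'}$ for $z\ne z'$. Let $k_z$ be the multiplicative order of $p_z$ in $(\mathbb{Z}/(p_{z-1}))^*$, and put $$l_z=\begin{cases}\max\{\nu(k_z)k_z,\ \nu(k_{z-1})k_{z-1}\}\,(\nu(k_z)k_z+1) & \text{if } p_{z-1}\ne 2,\\ 2\nu(k_{z-1})k_{z-1} & \text{if } p_{z-1}=2,\end{cases}$$ where $\nu(k)=1$ if $k$ is even and $\nu(k)=2$ if $k$ is odd. Then for every $n$-tuple of integers $m_1\ge l_1,\dots,m_n\ge l_n$ there exists a simple left brace of order $p_1^{m_1}p_2^{m_2}\cdots p_n^{m_n}$ whose multiplicative group is metabelian with all Sylow subgroups abelian.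
   Context: A left brace is a set $B$ with two operations $+,\cdot$ such that $(B,+)$ is an abelian group, $(B,\cdot)$ is a group and $a(b+c)+a=ab+ac$ for all $a,b,c$; $\lambda_a(b)=ab-a$. A left ideal is a subgroup $L$ of $(B,+)$ with $\lambda_b(L)\subseteq L$ for all $b$; an ideal is a left ideal that is a normal subgroup of $(B,\cdot)$; $B$ is simple if $B\neq 0$ and its only ideals are $0$ and $B$. Metabelian means derived length at most $2$. Indices $z\in\mathbb{Z}/(n)$, so $z-1$ is taken mod $n$. *)

theory Defs
  imports "HOL-Algebra.Algebra" "HOL-Number_Theory.Number_Theory"
begin

definition add_grp :: "'a set \<Rightarrow> ('a \<Rightarrow> 'a \<Rightarrow> 'a) \<Rightarrow> 'a monoid" where
  "add_grp B ad = \<lparr>carrier = B, monoid.mult = ad, one = (THE z. z \<in> B \<and> (\<forall>x\<in>B. ad z x = x))\<rparr>"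

definition mul_grp :: "'a set \<Rightarrow> ('a \<Rightarrow> 'a \<Rightarrow> 'a) \<Rightarrow> 'a monoid" where
  "mul_grp B mu = \<lparr>carrier = B, monoid.mult = mu, one = (THE e. e \<in> B \<and> (\<forall>x\<in>B. mu e x = x))\<rparr>"

definition left_brace :: "'a set \<Rightarrow> ('a \<Rightarrow> 'a \<Rightarrow> 'a) \<Rightarrow> ('a \<Rightarrow> 'a \<Rightarrow> 'a) \<Rightarrow> bool" where
  "left_brace B ad mu \<longleftrightarrow>
     comm_group (add_grp B ad) \<and> group (mul_grp B mu) \<and>
     (\<forall>a\<in>B. \<forall>b\<in>B. \<forall>c\<in>B. ad (mu a (ad b c)) a = ad (mu a b) (mu a c))"

definition brace_lambda :: "'a set \<Rightarrow> ('a \<Rightarrow> 'a \<Rightarrow> 'a) \<Rightarrow> ('a \<Rightarrow> 'a \<Rightarrow> 'a) \<Rightarrow> 'a \<Rightarrow> 'a \<Rightarrow> 'a" where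
  "brace_lambda B ad mu a b = ad (mu a b) (inv\<^bsub>add_grp B ad\<^esub> a)"

definition left_ideal :: "'a set \<Rightarrow> ('a \<Rightarrow> 'a \<Rightarrow> 'a) \<Rightarrow> ('a \<Rightarrow> 'a \<Rightarrow> 'a) \<Rightarrow> 'a set \<Rightarrow> bool" where
  "left_ideal B ad mu L \<longleftrightarrow>
     subgroup L (add_grp B ad) \<and> (\<forall>b\<in>B. \<forall>x\<in>L. brace_lambda B ad mu b x \<in> L)"

definition brace_ideal :: "'a set \<Rightarrow> ('a \<Rightarrow> 'a \<Rightarrow> 'a) \<Rightarrow> ('a \<Rightarrow> 'a \<Rightarrow> 'a) \<Rightarrow> 'a set \<Rightarrow> bool" where
  "brace_ideal B ad mu I \<longleftrightarrow> left_ideal B ad mu I \<and> normal I (mul_grp B mu)"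

definition simple_brace :: "'a set \<Rightarrow> ('a \<Rightarrow> 'a \<Rightarrow> 'a) \<Rightarrow> ('a \<Rightarrow> 'a \<Rightarrow> 'a) \<Rightarrow> bool" where
  "simple_brace B ad mu \<longleftrightarrow> left_brace B ad mu \<and>
     B \<noteq> {\<one>\<^bsub>add_grp B ad\<^esub>} \<and>
     (\<forall>I. brace_ideal B ad mu I \<longrightarrow> I = {\<one>\<^bsub>add_grp B ad\<^esub>} \<or> I = B)"

definition metabelian :: "('a, 'b) monoid_scheme \<Rightarrow> bool" where
  "metabelian G \<longleftrightarrow> derived G (derived G (carrier G)) = {\<one>\<^bsub>G\<^esub>}"

definition sylow_abelian :: "('a, 'b) monoid_scheme \<Rightarrow> bool" where
  "sylow_abelian G \<longleftrightarrow> (\<forall>p::nat. \<forall>H. Factorial_Ring.prime p \<and> subgroup H G \<and>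
       card H = p ^ multiplicity p (order G) \<longrightarrow> comm_group (G\<lparr>carrier := H\<rparr>))"

definition nu :: "nat \<Rightarrow> nat" where
  "nu k = (if even k then 1 else 2)"

text \<open>Predecessor in Z/(n), indices represented by 0..n-1.\<close>
definition zpred :: "nat \<Rightarrow> nat \<Rightarrow> nat" where
  "zpred n z = (z + n - 1) mod n"

end

theory Submission
  imports Defs "HOL-Library.Function_Algebras" "HOL-Algebra.Algebraic_Closure_Type"
begin

text \<open>
  The brace is \<open>B = S \<times> T\<close> with
  \<open>(s, t) (s', t') = (s + t \<cdot> s', t + t')\<close> and \<open>(s, t) + (s', t') = (s + s', t + t' + b s s')\<close>, where
  the abelian group \<open>T\<close> acts on the abelian group \<open>S\<close> and \<open>b\<close> is a \<open>T\<close>-invariant symmetric biadditive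
  map from \<open>S\<close> to \<open>T\<close>. Here \<open>S\<close> is the sum over \<open>z\<close> of \<open>u\<^sub>z\<close> copies of a space \<open>U\<^sub>z\<close> over the field with
  \<open>p\<^sub>z\<close> elements, \<open>T\<close> is the sum of elementary abelian groups of order \<open>p\<^sub>z ^ r\<^sub>z\<close>, the \<open>(z-1)\<close>-part of \<open>T\<close>
  acts on the \<open>z\<close>-part of \<open>S\<close>, and \<open>b\<close> maps the \<open>z\<close>-part of \<open>S\<close> to the \<open>z\<close>-part of \<open>T\<close>.

  \<open>U\<^sub>z\<close> is a cyclic code of length \<open>l = p\<^sub>z\<^sub>-\<^sub>1\<close>, that is, a shift-invariant space of \<open>l\<close>-periodic
  sequences, with zero coordinate sum and invariant under reversal. A minimal cyclic code is a field in
  which the \<open>k\<^sub>z\<close>-th power of the Frobenius map is trivial, so it has dimension at most \<open>k\<^sub>z\<close>, and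
  adding its reversal at most doubles this, or changes nothing if \<open>k\<^sub>z\<close> is even. Reversal
  invariance makes the dot product nondegenerate on \<open>U\<^sub>z\<close>.

  Simplicity: a nonzero ideal meets \<open>T\<close> by nondegeneracy. A nonzero element of its \<open>z\<close>-part acts without
  fixed points on a copy of \<open>U\<^sub>z\<^sub>+\<^sub>1\<close>, which therefore lies in the ideal, and \<open>b\<close> then gives elements of
  the \<open>(z+1)\<close>-part of \<open>T\<close>; going around the cycle yields everything. The order condition is met by
  writing \<open>m\<^sub>z = d\<^sub>z u\<^sub>z + r\<^sub>z\<close> with \<open>d\<^sub>z = dim U\<^sub>z\<close> and \<open>1 \<le> r\<^sub>z \<le> d\<^sub>z\<close>; the bounds on \<open>m\<^sub>z\<close> ensure that
  \<open>u\<^sub>z\<close> is at least \<open>r\<^sub>z\<close> and \<open>r\<^sub>z\<^sub>-\<^sub>1\<close>.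
\<close>

section \<open>Prime fields in a common ring\<close>

text \<open>The ring \<open>\<Prod>\<^sub>q \<int>/q\<close> over all natural numbers \<open>q\<close>: the field with \<open>p\<close> elements is its
  \<open>p\<close>-th factor, generated by the idempotent \<open>idem p\<close>. So vectors over different prime fields
  have the same type.\<close>

quotient_type residues_ring = "nat \<Rightarrow> int" / "\<lambda>f g. \<forall>q. f q mod int q = g q mod int q"
  by (rule equivpI) (auto simp: reflp_def symp_def transp_def)

instantiation residues_ring :: comm_ring_1
begin
lift_definition zero_residues_ring :: residues_ring is "\<lambda>_. 0" .
lift_definition one_residues_ring :: residues_ring is "\<lambda>_. 1" .
lift_definition plus_residues_ring :: "residues_ring \<Rightarrow> residues_ring \<Rightarrow> residues_ring"
  is "\<lambda>f g q. f q + g q" by (metis mod_add_cong)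
lift_definition minus_residues_ring :: "residues_ring \<Rightarrow> residues_ring \<Rightarrow> residues_ring"
  is "\<lambda>f g q. f q - g q" by (metis mod_diff_cong)
lift_definition times_residues_ring :: "residues_ring \<Rightarrow> residues_ring \<Rightarrow> residues_ring"
  is "\<lambda>f g q. f q * g q" by (metis mod_mult_cong)
lift_definition uminus_residues_ring :: "residues_ring \<Rightarrow> residues_ring"
  is "\<lambda>f q. - f q" by (metis mod_minus_cong)
instance
proof
  show "(0::residues_ring) \<noteq> 1"
    by transfer (auto intro!: exI[of _ 0])
qed (transfer; simp add: algebra_simps)+
end

lift_definition idem :: "nat \<Rightarrow> residues_ring" is "\<lambda>p q. if q = p then 1 else 0" .

lemma idem_mult_self [simp]: "idem p * idem p = idem p"
  by transfer simp

lemma of_int_residues_ring: "of_int k = abs_residues_ring (\<lambda>_. k)"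
proof (induction k)
  case (nonneg n)
  then show ?case
    by (induction n) (simp_all add: zero_residues_ring_def one_residues_ring_def plus_residues_ring.abs_eq)
next
  case (neg n)
  have "of_nat k = abs_residues_ring (\<lambda>_. int k)" for k
    by (induction k) (simp_all add: zero_residues_ring_def one_residues_ring_def plus_residues_ring.abs_eq)
  from this[of "Suc n"] show ?case
    by (simp add: uminus_residues_ring.abs_eq del: of_nat_Suc)
qed

lemma of_int_mult_idem_eq_0_iff: "of_int k * idem p = 0 \<longleftrightarrow> int p dvd k"
  unfolding of_int_residues_ring
  by transfer (auto simp: dvd_eq_mod_eq_0)

lemma of_int_mult_idem_eq_iff: "of_int k * idem p = of_int m * idem p \<longleftrightarrow> [k = m] (mod int p)"
  using of_int_mult_idem_eq_0_iff[of "k - m" p] by (simp add: algebra_simps cong_iff_dvd_diff)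

definition gf :: "nat \<Rightarrow> residues_ring set" where
  "gf p = range (\<lambda>k. of_int k * idem p)"

text \<open>An arbitrary integer representative, meaningful only modulo \<open>p\<close>. It serves
  where a field element becomes a polynomial coefficient or the amount of a shift.\<close>

definition rep :: "nat \<Rightarrow> residues_ring \<Rightarrow> int" where
  "rep p x = (SOME k. x = of_int k * idem p)"

lemma of_int_rep: "x \<in> gf p \<Longrightarrow> of_int (rep p x) * idem p = x"
  unfolding gf_def rep_def by (metis (mono_tags, lifting) rangeE someI_ex)

lemma gf_I [simp, intro]: "of_int k * idem p \<in> gf p"
  by (auto simp: gf_def)

lemma idem_in_gf [simp]: "idem p \<in> gf p"
  using gf_I[of 1 p] by simp

lemma idem_mult_gf [simp]: "x \<in> gf p \<Longrightarrow> idem p * x = x"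
  by (auto simp: gf_def mult_ac)

lemma gf_0 [simp]: "0 \<in> gf p"
  using gf_I[of 0 p] by simp

lemma gf_add [simp]: "x \<in> gf p \<Longrightarrow> y \<in> gf p \<Longrightarrow> x + y \<in> gf p"
  by (auto simp: gf_def image_iff simp flip: distrib_right of_int_add)

lemma gf_minus [simp]: "x \<in> gf p \<Longrightarrow> - x \<in> gf p"
  by (auto simp: gf_def image_iff simp flip: mult_minus_left of_int_minus)

lemma gf_mult_of_int [simp]: "x \<in> gf p \<Longrightarrow> of_int k * x \<in> gf p"
  by (auto simp: gf_def image_iff simp flip: mult.assoc of_int_mult)

lemma of_int_rep_mult:
  assumes "x \<in> gf p" "y \<in> gf p"
  shows "of_int (rep p x) * y = x * y"
proof -
  have "of_int (rep p x) * y = of_int (rep p x) * (idem p * y)" using assms by simp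
  also have "\<dots> = x * y"
    unfolding mult.assoc[symmetric] of_int_rep[OF assms(1)] ..
  finally show ?thesis .
qed

lemma gf_mult [simp]: "x \<in> gf p \<Longrightarrow> y \<in> gf p \<Longrightarrow> x * y \<in> gf p"
  using of_int_rep_mult gf_mult_of_int by metis

lemma gf_sum [simp]: "(\<And>i. i \<in> I \<Longrightarrow> f i \<in> gf p) \<Longrightarrow> sum f I \<in> gf p"
  by (induction I rule: infinite_finite_induct) auto

lemma rep_cong: "[rep p (of_int k * idem p) = k] (mod int p)"
  using of_int_rep[OF gf_I] of_int_mult_idem_eq_iff by blast

lemma rep_add_cong:
  assumes "x \<in> gf p" "y \<in> gf p"
  shows "[rep p (x + y) = rep p x + rep p y] (mod int p)"
  using rep_cong[of p "rep p x + rep p y"] assms by (simp add: distrib_right of_int_rep)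

lemma rep_eq_0_iff: "x \<in> gf p \<Longrightarrow> int p dvd rep p x \<longleftrightarrow> x = 0"
  using of_int_mult_idem_eq_0_iff[of "rep p x" p] by (simp add: of_int_rep)

lemma gf_char: "x \<in> gf p \<Longrightarrow> of_int (int p * k) * x = 0"
  by (metis dvd_triv_left idem_mult_gf mult.assoc mult_zero_left of_int_mult_idem_eq_0_iff)

lemma gf_eq_image: "p > 0 \<Longrightarrow> gf p = (\<lambda>k. of_int k * idem p) ` {0..<int p}"
proof (intro equalityI subsetI)
  fix x assume "p > 0" "x \<in> gf p"
  then have "x = of_int (rep p x mod int p) * idem p"
    by (subst of_int_rep[of x p, symmetric]) (auto simp: of_int_mult_idem_eq_iff)
  with \<open>p > 0\<close> show "x \<in> (\<lambda>k. of_int k * idem p) ` {0..<int p}"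
    by (auto intro!: image_eqI[of _ _ "rep p x mod int p"])
qed auto

lemma card_gf: "p > 0 \<Longrightarrow> card (gf p) = p"
  by (subst gf_eq_image, assumption, subst card_image)
    (auto simp: inj_on_def of_int_mult_idem_eq_iff cong_def)

lemma finite_gf: "p > 0 \<Longrightarrow> finite (gf p)"
  by (simp add: gf_eq_image)

text \<open>The inverse is given as an integer, because the additive subgroups met later are closed
  under integer multiples but carry no other scalar action.\<close>

lemma gf_inverse:
  assumes "Factorial_Ring.prime p" "x \<in> gf p" "x \<noteq> 0"
  obtains k where "of_int k * x = idem p"
proof -
  have "coprime (rep p x) (int p)"
    using assms rep_eq_0_iff[of x p] prime_imp_coprime[of "int p" "rep p x"]
    by (simp add: coprime_commute)
  then obtain k where "[rep p x * k = 1] (mod int p)"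
    using cong_solve_coprime_int by blast
  then have "of_int (rep p x * k) * idem p = of_int 1 * idem p"
    using of_int_mult_idem_eq_iff by blast
  then have "of_int k * x = idem p"
    using of_int_rep[OF assms(2)] by (metis mult.assoc mult.commute mult_1 of_int_1 of_int_mult)
  then show ?thesis using that by blast
qed

section \<open>Cyclic codes closed under reversal\<close>

text \<open>The indeterminate acts as the shift by \<open>m\<close>. Varying \<open>m\<close> makes the Frobenius map
  and the reversal of sequences (\<open>m = -1\<close>) instances of the same operation.\<close>

definition act :: "int \<Rightarrow> int poly \<Rightarrow> (int \<Rightarrow> residues_ring) \<Rightarrow> int \<Rightarrow> residues_ring" where
  "act m f v = (\<lambda>i. \<Sum>j\<le>Polynomial.degree f. of_int (Polynomial.coeff f j) * v (i + m * int j))"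

lemma act_pCons: "act m (pCons a f) v = (\<lambda>i. of_int a * v i + act m f v (i + m))"
proof (cases "f = 0")
  case True
  then show ?thesis by (simp add: act_def fun_eq_iff)
next
  case False
  then show ?thesis
    by (simp add: act_def fun_eq_iff degree_pCons_eq sum.atMost_Suc_shift algebra_simps
        del: sum.atMost_Suc)
qed

lemma act_0_left [simp]: "act m 0 v = (\<lambda>i. 0)"
  by (simp add: act_def)

lemma act_0_right [simp]: "act m f (\<lambda>i. 0) = (\<lambda>i. 0)"
  by (simp add: act_def)

lemma act_1 [simp]: "act m 1 v = v"
  by (simp add: one_pCons act_pCons)

lemma act_add_left: "act m (f + g) v = (\<lambda>i. act m f v i + act m g v i)"
  by (induction f g rule: poly_induct2) (simp_all add: act_pCons algebra_simps)

lemma act_smult: "act m (Polynomial.smult c f) v = (\<lambda>i. of_int c * act m f v i)"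
  by (induction f) (simp_all add: act_pCons algebra_simps)

lemma act_uminus_left: "act m (- f) v = (\<lambda>i. - act m f v i)"
  using act_smult[of m "-1" f v] by simp

lemma act_diff_left: "act m (f - g) v = (\<lambda>i. act m f v i - act m g v i)"
  using act_add_left[of m f "- g" v] by (simp add: act_uminus_left)

lemma act_mult: "act m (f * g) v = act m f (act m g v)"
  by (induction f) (simp_all add: act_pCons act_add_left act_smult)

lemma act_sum_left: "act m (sum f I) v = (\<lambda>i. \<Sum>j\<in>I. act m (f j) v i)"
  by (induction I rule: infinite_finite_induct) (simp_all add: act_add_left)

lemma act_monom: "act m (Polynomial.monom c j) v = (\<lambda>i. of_int c * v (i + m * int j))"
proof (induction j)
  case 0
  then show ?case by (simp add: monom_0 act_pCons)
next
  case (Suc j)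
  then show ?case by (simp add: monom_Suc act_pCons algebra_simps)
qed

lemma act_reverse: "act m f (\<lambda>i. v (- i)) = (\<lambda>i. act (- m) f v (- i))"
  by (simp add: act_def)

text \<open>Polynomials have integer coefficients here, so the usual identity in characteristic
  \<open>p\<close> carries an explicit multiple of \<open>p\<close>; that term dies only when acting
  on sequences over the prime field.\<close>

lemma binomial_prime_power_cong:
  assumes "Factorial_Ring.prime p"
  obtains h where "(a + b :: 'a :: comm_ring_1) ^ p = a ^ p + b ^ p + of_nat p * h"
proof -
  have p: "p \<ge> 2" using assms by (rule prime_ge_2_nat)
  have "\<forall>k\<in>{0<..<p}. \<exists>c. p choose k = p * c"
  proof
    fix k assume "k \<in> {0<..<p}"
    then have "p dvd (p choose k)" using assms by (intro dvd_choose_prime) auto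
    then show "\<exists>c. p choose k = p * c" by (auto elim: dvdE)
  qed
  then obtain c where c: "\<And>k. k \<in> {0<..<p} \<Longrightarrow> p choose k = p * c k" by metis
  have "(a + b) ^ p = (\<Sum>k\<le>p. of_nat (p choose k) * a ^ k * b ^ (p - k))"
    by (rule binomial_ring)
  also have "{..p} = insert 0 (insert p {0<..<p})" using p by auto
  also have "(\<Sum>k\<in>insert 0 (insert p {0<..<p}). of_nat (p choose k) * a ^ k * b ^ (p - k)) =
      b ^ p + (a ^ p + (\<Sum>k\<in>{0<..<p}. of_nat (p choose k) * a ^ k * b ^ (p - k)))"
    using p by simp
  also have "(\<Sum>k\<in>{0<..<p}. of_nat (p choose k) * a ^ k * b ^ (p - k)) =
      of_nat p * (\<Sum>k\<in>{0<..<p}. of_nat (c k) * a ^ k * b ^ (p - k))"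
    unfolding sum_distrib_left by (intro sum.cong refl) (simp add: c mult_ac)
  finally have "(a + b) ^ p = a ^ p + b ^ p +
      of_nat p * (\<Sum>k\<in>{0<..<p}. of_nat (c k) * a ^ k * b ^ (p - k))"
    by (simp only: add_ac)
  then show ?thesis by (rule that)
qed

section \<open>Periodic sequences over a prime field and the Frobenius map\<close>

definition cyc :: "nat \<Rightarrow> nat \<Rightarrow> (int \<Rightarrow> residues_ring) set" where
  "cyc p l = {v. (\<forall>i. v i \<in> gf p) \<and> (\<forall>i. v (i + int l) = v i)}"

lemma cyc_gf: "v \<in> cyc p l \<Longrightarrow> v i \<in> gf p"
  by (simp add: cyc_def)

lemma periodic_cong:
  fixes v :: "int \<Rightarrow> 'a"
  assumes "\<And>i. v (i + int l) = v i" and "[i = j] (mod int l)"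
  shows "v i = v j"
proof -
  have *: "v (i + int l * int k) = v i" for i k
  proof (induction k)
    case (Suc k)
    then show ?case using assms(1)[of "i + int l * int k"] by (simp add: algebra_simps)
  qed simp
  obtain c where c: "i = j + int l * c"
    using assms(2) by (metis add.commute cong_iff_lin cong_sym)
  show ?thesis
  proof (cases "c \<ge> 0")
    case True
    then show ?thesis using *[of j "nat c"] c by simp
  next
    case False
    then show ?thesis using *[of i "nat (- c)"] c by simp
  qed
qed

lemma cyc_cong: "v \<in> cyc p l \<Longrightarrow> [i = j] (mod int l) \<Longrightarrow> v i = v j"
  using periodic_cong[of v l i j] by (simp add: cyc_def)

lemma act_in_cyc:
  assumes "v \<in> cyc p l"
  shows "act m f v \<in> cyc p l"
proof -
  have "act m f v (i + int l) = act m f v i" for i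
    unfolding act_def
    by (intro sum.cong refl arg_cong2[of _ _ _ _ "(*)"] cyc_cong[OF assms]) (simp add: cong_iff_dvd_diff)
  moreover have "act m f v i \<in> gf p" for i
    unfolding act_def by (intro gf_sum gf_mult_of_int cyc_gf[OF assms])
  ultimately show ?thesis by (simp add: cyc_def)
qed

lemma act_stride_cong:
  assumes "v \<in> cyc p l" "[m = m'] (mod int l)"
  shows "act m f v = act m' f v"
  unfolding act_def using assms
  by (intro ext sum.cong arg_cong2[of _ _ _ _ "(*)"] refl cyc_cong[of v p l] cong_add cong_mult) auto

text \<open>Modulo \<open>p\<close>, f(X)^p equals f(X^p), and X^p acts as the shift by
  \<open>m * int p\<close>. Taking \<open>p\<close>-th powers thus becomes a change of
  stride.\<close>

lemma act_frobenius:
  assumes p: "Factorial_Ring.prime p" and v: "v \<in> cyc p l"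
  shows "act m (f ^ p) v = act (m * int p) f v"
proof (induction f)
  case 0
  then show ?case using prime_gt_0_nat[OF p] by (simp add: zero_power)
next
  case (pCons a f)
  have f: "pCons a f = [:a:] + Polynomial.monom 1 1 * f"
    by (simp add: monom_altdef)
  obtain h where "(pCons a f) ^ p = [:a:] ^ p + (Polynomial.monom 1 1 * f) ^ p + of_nat p * h"
    unfolding f by (rule binomial_prime_power_cong[OF p])
  also have "[:a:] ^ p = [:a ^ p:]"
    by (simp add: poly_const_pow)
  also have "(Polynomial.monom 1 1 * f) ^ p = Polynomial.monom 1 p * f ^ p"
    by (simp add: power_mult_distrib monom_power)
  also have "of_nat p * h = Polynomial.smult (int p) h"
    by (simp add: of_nat_poly)
  finally have "act m ((pCons a f) ^ p) v =
      (\<lambda>i. of_int (a ^ p) * v i + act m (f ^ p) v (i + m * int p) + of_int (int p * 1) * act m h v i)"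
    by (simp add: act_add_left act_pCons act_mult act_monom act_smult)
  also have "\<dots> = (\<lambda>i. of_int a * v i + act m (f ^ p) v (i + m * int p))"
  proof
    fix i
    \<comment> \<open>Fermat's little theorem, extended to multiples of \<open>p\<close>.\<close>
    have "[a ^ p = a] (mod int p)"
    proof (cases "int p dvd a")
      case True
      then show ?thesis using prime_gt_0_nat[OF p]
        by (metis cong_0_iff cong_sym cong_trans dvd_power dvd_trans)
    next
      case False
      have "[a mod int p = a] (mod int p)" by simp
      moreover have "[int (nat (a mod int p) ^ (p - 1)) = int 1] (mod int p)"
        unfolding cong_int_iff using False prime_gt_0_nat[OF p]
        by (intro fermat_theorem[OF p]) (simp add: nat_dvd_iff dvd_mod_iff int_dvd_int_iff[symmetric] del: int_dvd_int_iff)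
      ultimately have "[a ^ (p - 1) = 1] (mod int p)"
        using prime_gt_0_nat[OF p] by (simp add: cong_def power_mod)
      then have "[a ^ (p - 1) * a = 1 * a] (mod int p)"
        by (rule cong_mult) simp
      then show ?thesis
        using prime_gt_0_nat[OF p] by (simp flip: power_Suc2)
    qed
    then have "of_int (a ^ p) * idem p = of_int a * idem p"
      by (simp only: of_int_mult_idem_eq_iff)
    then have "of_int (a ^ p) * v i = of_int a * v i"
      by (metis cyc_gf[OF v] idem_mult_gf mult.assoc)
    moreover have "of_int (int p * 1) * act m h v i = 0"
      by (rule gf_char) (rule cyc_gf[OF act_in_cyc[OF v]])
    ultimately show "of_int (a ^ p) * v i + act m (f ^ p) v (i + m * int p) + of_int (int p * 1) * act m h v i
        = of_int a * v i + act m (f ^ p) v (i + m * int p)"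
      by simp
  qed
  finally show ?case by (simp add: pCons.IH act_pCons)
qed

lemma act_frobenius_power:
  assumes "Factorial_Ring.prime p" "v \<in> cyc p l"
  shows "act m (f ^ (p ^ k)) v = act (m * int (p ^ k)) f v"
proof (induction k arbitrary: m)
  case (Suc k)
  have "act m (f ^ p ^ Suc k) v = act m ((f ^ p ^ k) ^ p) v"
    by (simp add: mult.commute flip: power_mult)
  then show ?case
    using act_frobenius[OF assms, of m "f ^ p ^ k"] Suc by (simp add: mult_ac)
qed simp

section \<open>Convolution and the group ring of a cyclic group\<close>

definition delta :: "nat \<Rightarrow> nat \<Rightarrow> int \<Rightarrow> residues_ring" where
  "delta p l i = (if int l dvd i then idem p else 0)"

text \<open>The group ring element that acts on \<open>cyc p l\<close> as convolution with
  \<open>v\<close>. Shifting by \<open>j\<close> moves the peak of \<open>delta\<close> to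
  \<open>- j\<close>, hence the sign.\<close>

definition poly_of :: "nat \<Rightarrow> nat \<Rightarrow> (int \<Rightarrow> residues_ring) \<Rightarrow> int poly" where
  "poly_of p l v = (\<Sum>j<l. Polynomial.monom (rep p (v (- int j))) j)"

lemma delta_in_cyc: "delta p l \<in> cyc p l"
  by (auto simp: cyc_def delta_def)

lemma act_poly_of:
  assumes "v \<in> cyc p l" "w \<in> cyc p l"
  shows "act 1 (poly_of p l v) w i = (\<Sum>j<l. v (- int j) * w (i + int j))"
  using assms by (simp add: poly_of_def act_sum_left act_monom of_int_rep_mult cyc_gf)

text \<open>\<open>delta\<close> is the unit of convolution, so all of \<open>cyc p l\<close> is a
  single orbit, that of \<open>delta\<close>.\<close>

lemma act_poly_of_delta:
  assumes "l > 0" "v \<in> cyc p l"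
  shows "act 1 (poly_of p l v) (delta p l) = v"
proof
  fix i
  \<comment> \<open>The only index below \<open>l\<close> at which
    \<open>delta p l (i + int j)\<close> is nonzero.\<close>
  define k where "k = nat ((- i) mod int l)"
  have k: "k < l" "[int k = - i] (mod int l)"
    using assms(1) by (auto simp: k_def nat_less_iff)
  have "act 1 (poly_of p l v) (delta p l) i = (\<Sum>j<l. if j = k then v i else 0)"
    unfolding act_poly_of[OF assms(2) delta_in_cyc]
  proof (intro sum.cong refl)
    fix j assume j: "j \<in> {..<l}"
    show "v (- int j) * delta p l (i + int j) = (if j = k then v i else 0)"
    proof (cases "j = k")
      case True
      have "int l dvd i + int k"
        using k(2) by (simp add: cong_iff_dvd_diff add.commute)
      moreover have "v (- int k) = v i"
        using cong_uminus[OF k(2)] by (intro cyc_cong[OF assms(2)]) simp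
      ultimately show ?thesis
        using True cyc_gf[OF assms(2), of i] idem_mult_gf by (simp add: delta_def mult.commute)
    next
      case False
      have "\<not> int l dvd i + int j"
      proof
        assume "int l dvd i + int j"
        then have "[int j = - i] (mod int l)" by (simp add: cong_iff_dvd_diff add.commute)
        then have "[int j = int k] (mod int l)" using k(2) cong_sym cong_trans by blast
        then show False using False j k(1) by (simp add: cong_int_iff cong_def)
      qed
      then show ?thesis using False by (simp add: delta_def)
    qed
  qed
  then show "act 1 (poly_of p l v) (delta p l) i = v i"
    using k(1) by simp
qed

text \<open>The group ring of a cyclic group of order prime to \<open>p\<close> is reduced, since a power of the
  Frobenius map is the identity.\<close>

lemma convolution_square_nonzero:
  assumes p: "Factorial_Ring.prime p" and l: "Factorial_Ring.prime l" and "p \<noteq> l"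
    and v: "v \<in> cyc p l" "v \<noteq> (\<lambda>i. 0)"
  shows "act 1 (poly_of p l v) v \<noteq> (\<lambda>i. 0)"
proof
  define k where "k = ord l p"
  define f where "f = poly_of p l v"
  assume *: "act 1 (poly_of p l v) v = (\<lambda>i. 0)"
  have "coprime l p" using p l \<open>p \<noteq> l\<close> by (simp add: primes_coprime)
  then have "k > 0" by (simp add: k_def)
  then have "p ^ k \<ge> 2"
    using prime_ge_2_nat[OF p] self_le_power[of p k] by linarith
  have fd: "act 1 f (delta p l) = v"
    using v prime_gt_0_nat[OF l] by (simp add: f_def act_poly_of_delta)
  \<comment> \<open>The stride \<open>p ^ k\<close> is 1 modulo \<open>l\<close>, so
    \<open>f ^ (p ^ k)\<close> and \<open>f\<close> agree on \<open>delta\<close>. But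
    \<open>f * f\<close> kills \<open>delta\<close> and divides \<open>f ^ (p ^ k)\<close>.\<close>
  have "[p ^ k = 1] (mod l)" unfolding k_def by (rule ord)
  then have "[1 = 1 * int (p ^ k)] (mod int l)"
    by (metis cong_int_iff cong_sym mult_1 of_nat_1)
  then have "act 1 f (delta p l) = act (1 * int (p ^ k)) f (delta p l)"
    by (rule act_stride_cong[OF delta_in_cyc])
  also have "\<dots> = act 1 (f ^ (p ^ k)) (delta p l)"
    by (rule act_frobenius_power[OF p delta_in_cyc, symmetric])
  also have "f ^ (p ^ k) = f ^ (p ^ k - 2) * (f * f)"
    using \<open>p ^ k \<ge> 2\<close> by (metis le_add_diff_inverse2 power2_eq_square power_add)
  also have "act 1 \<dots> (delta p l) = (\<lambda>i. 0)"
    using * by (simp add: act_mult fd f_def[symmetric])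
  finally show False using fd v(2) by simp
qed

section \<open>Sequences with zero sum and minimal cyclic codes\<close>

lemma sum_periodic_shift:
  fixes g :: "int \<Rightarrow> 'a :: comm_monoid_add"
  assumes "l > 0" and g: "\<And>i. g (i + int l) = g i"
  shows "(\<Sum>i<l. g (int i + c)) = (\<Sum>i<l. g (int i))"
  by (rule sum.reindex_bij_witness[of _ "\<lambda>i. nat ((int i - c) mod int l)" "\<lambda>i. nat ((int i + c) mod int l)"])
    (use assms(1) in \<open>auto simp: nat_less_iff mod_simps cong_def intro!: periodic_cong[of g l, OF g]\<close>)

lemma sum_periodic_reverse:
  fixes g :: "int \<Rightarrow> 'a :: comm_monoid_add"
  assumes "l > 0" and g: "\<And>i. g (i + int l) = g i"
  shows "(\<Sum>i<l. g (- int i)) = (\<Sum>i<l. g (int i))"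
  by (rule sum.reindex_bij_witness[of _ "\<lambda>i. nat ((- int i) mod int l)" "\<lambda>i. nat ((- int i) mod int l)"])
    (use assms(1) in \<open>auto simp: nat_less_iff mod_simps cong_def intro!: periodic_cong[of g l, OF g]\<close>)

text \<open>For distinct primes \<open>p\<close> and \<open>l\<close>, the zero sum excludes nonzero
  constant sequences, the only nonzero ones that a nontrivial shift can fix.\<close>

definition cyc0 :: "nat \<Rightarrow> nat \<Rightarrow> (int \<Rightarrow> residues_ring) set" where
  "cyc0 p l = {v \<in> cyc p l. (\<Sum>i<l. v (int i)) = 0}"

lemma cyc0_subset: "v \<in> cyc0 p l \<Longrightarrow> v \<in> cyc p l"
  by (simp add: cyc0_def)

lemma finite_cyc:
  assumes "p > 0" "l > 0"
  shows "finite (cyc p l)"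
proof (rule finite_subset)
  show "cyc p l \<subseteq> (\<lambda>g i. g (i mod int l)) ` (PiE {0..<int l} (\<lambda>_. gf p))"
  proof
    fix v assume v: "v \<in> cyc p l"
    have "v i = restrict v {0..<int l} (i mod int l)" for i
      using assms cyc_cong[OF v, of i "i mod int l"] by simp
    then have "v = (\<lambda>i. restrict v {0..<int l} (i mod int l))" by blast
    moreover have "restrict v {0..<int l} \<in> PiE {0..<int l} (\<lambda>_. gf p)"
      using cyc_gf[OF v] by simp
    ultimately show "v \<in> (\<lambda>g i. g (i mod int l)) ` (PiE {0..<int l} (\<lambda>_. gf p))"
      by (rule image_eqI)
  qed
  show "finite ((\<lambda>g i. g (i mod int l)) ` (PiE {0..<int l} (\<lambda>_. gf p)))"
    using assms by (intro finite_imageI finite_PiE) (auto intro: finite_gf)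
qed

lemma act_in_cyc0:
  assumes "l > 0" "v \<in> cyc0 p l"
  shows "act m f v \<in> cyc0 p l"
proof -
  have v: "v \<in> cyc p l" using assms by (simp add: cyc0_def)
  have "(\<Sum>i<l. act m f v (int i)) =
      (\<Sum>j\<le>Polynomial.degree f. of_int (Polynomial.coeff f j) * (\<Sum>i<l. v (int i + m * int j)))"
    unfolding act_def sum_distrib_left by (rule sum.swap)
  also have "\<dots> = 0"
    using assms by (subst sum_periodic_shift) (auto simp: cyc0_def cyc_def)
  finally show ?thesis using act_in_cyc[OF v] by (simp add: cyc0_def)
qed

lemma cyc0_nonzero:
  assumes "Factorial_Ring.prime p" "Factorial_Ring.prime l"
  obtains v where "v \<in> cyc0 p l" "v \<noteq> (\<lambda>i. 0)"
proof -
  \<comment> \<open>Subtracting a shift cancels the sum, and \<open>l > 1\<close> keeps the two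
    peaks apart.\<close>
  define v where "v = (\<lambda>i. delta p l i - delta p l (i + 1))"
  have l: "l > 1" using assms(2) by (rule prime_gt_1_nat)
  have d: "delta p l (i + int l) = delta p l i" "delta p l i \<in> gf p" for i
    using delta_in_cyc[of p l] by (auto simp: cyc_def)
  have "(\<Sum>i<l. delta p l (int i + 1)) = (\<Sum>i<l. delta p l (int i))"
    using l d by (intro sum_periodic_shift) auto
  then have "(\<Sum>i<l. v (int i)) = 0"
    by (simp add: v_def sum_subtractf)
  moreover have "v (i + int l) = v i" for i
    using d(1)[of "i + 1"] d(1)[of i] by (simp add: v_def algebra_simps)
  moreover have "v i \<in> gf p" for i
    unfolding v_def diff_conv_add_uminus by (intro gf_add gf_minus d)
  ultimately have "v \<in> cyc0 p l" by (simp add: cyc0_def cyc_def)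
  moreover have "v 0 \<noteq> 0"
    using l of_int_mult_idem_eq_0_iff[of 1 p] assms(1) by (auto simp: v_def delta_def)
  then have "v \<noteq> (\<lambda>i. 0)" by auto
  ultimately show ?thesis using that by blast
qed

text \<open>Take a nonzero \<open>v\<close> whose orbit is smallest. A nonzero element of this orbit
  has an orbit that is contained in it and not smaller, hence contains \<open>v\<close>.\<close>

lemma cyc0_cyclic_simple:
  assumes p: "Factorial_Ring.prime p" and l: "Factorial_Ring.prime l"
  obtains v where "v \<in> cyc0 p l" "v \<noteq> (\<lambda>i. 0)"
    "\<And>f. act 1 f v \<noteq> (\<lambda>i. 0) \<Longrightarrow> \<exists>g. act 1 (g * f) v = v"
proof -
  define P where "P v \<longleftrightarrow> v \<in> cyc0 p l \<and> v \<noteq> (\<lambda>i. 0)" for v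
  define c where "c v = card (range (\<lambda>f. act 1 f v))" for v
  obtain v0 where "P v0" using cyc0_nonzero[OF p l] P_def by metis
  then obtain v where v: "P v" and min: "\<And>w. P w \<Longrightarrow> c v \<le> c w"
    using ex_has_least_nat[of P v0 c] by blast
  have pl: "p > 0" "l > 0" using p l by (simp_all add: prime_gt_0_nat)
  have "\<exists>g. act 1 (g * f) v = v" if f: "act 1 f v \<noteq> (\<lambda>i. 0)" for f
  proof -
    have "P (act 1 f v)" using v f pl act_in_cyc0 by (auto simp: P_def)
    then have "c v \<le> c (act 1 f v)" by (rule min)
    moreover have "range (\<lambda>g. act 1 g (act 1 f v)) \<subseteq> range (\<lambda>f. act 1 f v)"
      by (auto simp flip: act_mult)
    moreover have "finite (range (\<lambda>f. act 1 f v))"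
      by (rule finite_subset[OF _ finite_cyc[OF pl]]) (use v act_in_cyc in \<open>auto simp: P_def cyc0_def\<close>)
    ultimately have "range (\<lambda>g. act 1 g (act 1 f v)) = range (\<lambda>f. act 1 f v)"
      by (intro card_seteq) (simp_all add: c_def)
    moreover have "v \<in> range (\<lambda>f. act 1 f v)" by (rule image_eqI[of _ _ 1]) auto
    ultimately have "v \<in> range (\<lambda>g. act 1 g (act 1 f v))" by simp
    then show ?thesis unfolding act_mult by (auto dest: sym)
  qed
  then show ?thesis using that v by (auto simp: P_def)
qed

text \<open>The annihilator of \<open>v\<close> is a maximal ideal, so the orbit is a field, all of whose elements
  are fixed by the \<open>k\<close>-th power of the Frobenius map.\<close>

lemma card_simple_orbit_le:
  assumes p: "Factorial_Ring.prime p" and l: "Factorial_Ring.prime l"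
    and v: "v \<in> cyc0 p l" "v \<noteq> (\<lambda>i. 0)"
    and simple: "\<And>f. act 1 f v \<noteq> (\<lambda>i. 0) \<Longrightarrow> \<exists>g. act 1 (g * f) v = v"
    and k: "[p ^ k = 1] (mod l)" "k > 0"
  shows "card (range (\<lambda>f. act 1 f v)) \<le> p ^ k"
proof -
  define R where "R = (ring_of_type_algebra :: int poly ring)"
  have R [simp]: "carrier R = UNIV" "a \<otimes>\<^bsub>R\<^esub> b = a * b" "a \<oplus>\<^bsub>R\<^esub> b = a + b" "\<zero>\<^bsub>R\<^esub> = 0" "\<one>\<^bsub>R\<^esub> = 1" for a b
    by (simp_all add: R_def ring_of_type_algebra_def)
  have "cring R" unfolding R_def by (rule cring_from_type_algebra)
  then interpret R: cring R .
  have Rpow [simp]: "a [^]\<^bsub>R\<^esub> (i::nat) = a ^ i" for a i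
    by (induction i) (simp_all add: mult.commute)
  have Rminus [simp]: "\<ominus>\<^bsub>R\<^esub> a = - a" for a
    using R.minus_equality[of "- a" a] by simp
  have pl: "p > 0" "l > 0" using p l by (simp_all add: prime_gt_0_nat)
  define I where "I = {f. act 1 f v = (\<lambda>i. 0)}"
  have "ideal I R"
  proof (rule idealI)
    show "ring R" by (rule R.ring_axioms)
    show "subgroup I (add_monoid R)"
      by (rule R.add.subgroupI)
        (auto simp: I_def act_add_left act_uminus_left simp flip: a_inv_def intro: exI[of _ 0])
    show "\<And>a x. \<lbrakk>a \<in> I; x \<in> carrier R\<rbrakk> \<Longrightarrow> x \<otimes>\<^bsub>R\<^esub> a \<in> I"
      by (simp add: I_def act_mult)
    fix a x assume "a \<in> I" "x \<in> carrier R"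
    then show "a \<otimes>\<^bsub>R\<^esub> x \<in> I"
      using act_mult[of 1 x a v] by (simp add: I_def mult.commute)
  qed
  then interpret I: ideal I R .
  have "maximalideal I R"
  proof (rule maximalidealI)
    have "1 \<notin> I" using v by (simp add: I_def)
    then show "carrier R \<noteq> I" by auto
    fix J assume J: "ideal J R" "I \<subseteq> J" "J \<subseteq> carrier R"
    interpret J: ideal J R by (rule J(1))
    show "J = I \<or> J = carrier R"
    proof (rule disjCI)
      assume "J \<noteq> carrier R"
      have "f \<in> I" if "f \<in> J" for f
      proof (rule ccontr)
        assume "f \<notin> I"
        \<comment> \<open>An inverse \<open>g\<close> of \<open>f\<close> modulo the annihilator
          puts 1 into \<open>J\<close>.\<close>
        then obtain g where "act 1 (g * f) v = v" using simple by (auto simp: I_def)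
        then have "1 - g * f \<in> I" by (simp add: I_def act_diff_left)
        moreover have "g * f \<in> J" using J.I_l_closed[OF that, of g] by simp
        ultimately have "(1 - g * f) + g * f \<in> J" using J.a_closed J(2)
          by (metis R(3) subsetD)
        then have "1 \<in> J" by simp
        then show False using J.one_imp_carrier \<open>J \<noteq> carrier R\<close> by simp
      qed
      then show "J = I" using J(2) by blast
    qed
  qed (rule I.ideal_axioms)
  then have "field (R Quot I)"
    by (rule maximalideal.quotient_is_field) (rule R.cring_axioms)
  then interpret Q: field "R Quot I" .
  have hom: "(+>\<^bsub>R\<^esub>) I \<in> ring_hom R (R Quot I)" by (rule I.rcos_ring_hom)
  interpret h: ring_hom_cring R "R Quot I" "(+>\<^bsub>R\<^esub>) I"
    by (rule ring_hom_cringI) (use hom R.cring_axioms Q.cring_axioms in auto)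
  have coset: "I +>\<^bsub>R\<^esub> f = {g. act 1 g v = act 1 f v}" for f
  proof -
    have "g \<in> I +>\<^bsub>R\<^esub> f \<longleftrightarrow> g - f \<in> I" for g
      by (auto simp: a_r_coset_def' intro: bexI[of _ "g - f"])
    then show ?thesis
      by (auto simp: I_def act_diff_left fun_eq_iff)
  qed
  have carrier: "carrier (R Quot I) = range (\<lambda>f. I +>\<^bsub>R\<^esub> f)"
    by (auto simp: FactRing_def A_RCOSETS_def' )
  let ?V = "range (\<lambda>f. act 1 f v)"
  \<comment> \<open>A coset of the annihilator consists of the polynomials that send
    \<open>v\<close> to one common value, so cosets correspond to points of the orbit.\<close>
  have "bij_betw (\<lambda>w. {g. act 1 g v = w}) ?V (carrier (R Quot I))"
    unfolding bij_betw_def carrier coset by (auto simp: inj_on_def)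
  then have card: "card ?V = card (carrier (R Quot I))" by (rule bij_betw_same_card)
  have "finite ?V"
    by (rule finite_subset[OF _ finite_cyc[OF pl]]) (use v act_in_cyc in \<open>auto simp: cyc0_def\<close>)
  then have fin: "finite (carrier (R Quot I))"
    using \<open>bij_betw _ ?V _\<close> bij_betw_finite by blast
  have q: "p ^ k > 1" using p k(2) by (metis one_less_power prime_gt_1_nat)
  \<comment> \<open>By the Frobenius identity every nonzero element is a root of X^(p^k - 1) - 1,
    and a field has at most \<open>p ^ k - 1\<close> such roots.\<close>
  have "carrier (R Quot I) - {\<zero>\<^bsub>R Quot I\<^esub>} \<subseteq>
      {x \<in> carrier (R Quot I). x [^]\<^bsub>R Quot I\<^esub> (p ^ k - 1) = \<one>\<^bsub>R Quot I\<^esub>}"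
  proof
    fix x assume x: "x \<in> carrier (R Quot I) - {\<zero>\<^bsub>R Quot I\<^esub>}"
    then obtain f where f: "x = I +>\<^bsub>R\<^esub> f" using carrier by auto
    have "[1 * int (p ^ k) = 1] (mod int l)"
      using k(1) by (metis cong_int_iff mult_1 of_nat_1)
    then have "act 1 (f ^ (p ^ k)) v = act 1 f v"
      using act_frobenius_power[OF p cyc0_subset[OF v(1)], of 1 f k] act_stride_cong[OF cyc0_subset[OF v(1)]]
      by metis
    then have "I +>\<^bsub>R\<^esub> (f ^ (p ^ k)) = x" by (simp add: coset f)
    moreover have "I +>\<^bsub>R\<^esub> (f ^ i) = x [^]\<^bsub>R Quot I\<^esub> i" for i :: nat
      using h.hom_mult[of _ f] h.hom_one by (induction i) (simp_all add: f mult.commute[of f])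
    ultimately have "x [^]\<^bsub>R Quot I\<^esub> Suc (p ^ k - 1) = x"
      unfolding Suc_diff_1[OF less_trans[OF zero_less_one q]] by simp
    then have "x [^]\<^bsub>R Quot I\<^esub> (p ^ k - 1) \<otimes>\<^bsub>R Quot I\<^esub> x = \<one>\<^bsub>R Quot I\<^esub> \<otimes>\<^bsub>R Quot I\<^esub> x"
      using x by simp
    then have "x [^]\<^bsub>R Quot I\<^esub> (p ^ k - 1) = \<one>\<^bsub>R Quot I\<^esub>"
      by (rule iffD1[OF Q.m_rcancel, rotated 4]) (use x in simp_all)
    then show "x \<in> {x \<in> carrier (R Quot I). x [^]\<^bsub>R Quot I\<^esub> (p ^ k - 1) = \<one>\<^bsub>R Quot I\<^esub>}"
      using x by simp
  qed
  then have "card (carrier (R Quot I) - {\<zero>\<^bsub>R Quot I\<^esub>}) \<le>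
      card {x \<in> carrier (R Quot I). x [^]\<^bsub>R Quot I\<^esub> (p ^ k - 1) = \<one>\<^bsub>R Quot I\<^esub>}"
    by (intro card_mono) (use fin in simp_all)
  also have "\<dots> \<le> p ^ k - 1"
    by (rule Q.num_roots_le_deg[OF fin]) (use q in simp)
  finally show ?thesis using card fin q by (simp add: card_Diff_singleton)
qed

text \<open>A second prime \<open>q\<close> dividing the order would give an element of order
  \<open>q\<close>, against exponent \<open>p\<close>. Sylow's theorem with exponent 1 acts as
  Cauchy's theorem. Multiples are iterated sums because the elements lie in a bare additive
  group.\<close>

lemma card_elementary_abelian:
  fixes U :: "'a :: ab_group_add set"
  assumes p: "Factorial_Ring.prime p" and fin: "finite U"
    and U: "0 \<in> U" "\<And>x y. x \<in> U \<Longrightarrow> y \<in> U \<Longrightarrow> x + y \<in> U" "\<And>x. x \<in> U \<Longrightarrow> - x \<in> U"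
    and exp: "\<And>x. x \<in> U \<Longrightarrow> ((+) x ^^ p) 0 = 0"
  obtains d where "card U = p ^ d"
proof -
  define G where "G = \<lparr>carrier = U, monoid.mult = (+), one = (0::'a)\<rparr>"
  interpret G: comm_group G
    by (rule comm_groupI) (use U in \<open>auto simp: G_def add_ac intro!: bexI[of _ "- _"]\<close>)
  have pow: "x [^]\<^bsub>G\<^esub> (n::nat) = ((+) x ^^ n) 0" for x n
    by (induction n) (simp_all add: G_def add.commute)
  have "card U \<noteq> 0" using fin U(1) by auto
  then obtain y where y: "card U = p ^ multiplicity p (card U) * y" "\<not> p dvd y"
    using multiplicity_decompose'[of "card U" p] p by (metis not_prime_unit)
  have "y = 1"
  proof (rule ccontr)
    assume "y \<noteq> 1"
    then obtain q where q: "Factorial_Ring.prime q" "q dvd y" using prime_factor_nat by blast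
    then have "q \<noteq> p" using y by auto
    obtain m where "y = q * m" using q(2) by (rule dvdE)
    then have "Coset.order G = q ^ 1 * (p ^ multiplicity p (card U) * m)"
      using y(1) by (simp add: Coset.order_def G_def mult_ac)
    then obtain H where H: "subgroup H G" "card H = q ^ 1"
      using sylow_thm[OF q(1) G.group_axioms, of 1] fin by (auto simp: G_def)
    interpret H: group "G\<lparr>carrier := H\<rparr>" by (rule G.subgroup_imp_group[OF H(1)])
    have "H \<noteq> {\<one>\<^bsub>G\<^esub>}" using H(2) prime_gt_1_nat[OF q(1)] by auto
    then obtain x where x: "x \<in> H" "x \<noteq> \<one>\<^bsub>G\<^esub>"
      using subgroup.one_closed[OF H(1)] by blast
    have xG: "x \<in> carrier G" using x(1) H(1) subgroup.subset by blast
    have "x [^]\<^bsub>G\<lparr>carrier := H\<rparr>\<^esub> Coset.order (G\<lparr>carrier := H\<rparr>) = \<one>\<^bsub>G\<lparr>carrier := H\<rparr>\<^esub>"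
      using x(1) by (intro H.pow_order_eq_1) auto
    then have "x [^]\<^bsub>G\<^esub> q = \<one>\<^bsub>G\<^esub>"
      using H(2) by (simp add: Coset.order_def flip: G.nat_pow_consistent)
    moreover have "x [^]\<^bsub>G\<^esub> p = \<one>\<^bsub>G\<^esub>" using exp xG pow by (simp add: G_def)
    ultimately have "G.ord x dvd q" "G.ord x dvd p" using G.pow_eq_id[OF xG] by auto
    then have "G.ord x = 1"
      using primes_coprime[OF q(1) p \<open>q \<noteq> p\<close>] by (metis coprime_common_divisor_nat)
    then show False using G.ord_eq_1[OF xG] x(2) by blast
  qed
  then show ?thesis using y(1) that by (metis mult.right_neutral)
qed

lemma funpow_add_apply: "((+) f ^^ n) 0 i = of_nat n * (f i :: 'a :: comm_ring_1)"
  by (induction n) (simp_all add: distrib_right)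

lemma funpow_add_apply2: "((+) f ^^ n) 0 i j = of_nat n * (f i j :: 'a :: comm_ring_1)"
  by (induction n) (simp_all add: distrib_right)

text \<open>The code is \<open>V\<close> plus its reversal for a minimal orbit \<open>V\<close>.
  Nondegeneracy comes from pairing \<open>u\<close> with shifts of its own reversal: these pairings
  are the coordinates of the convolution square of \<open>u\<close>. The sharper dimension for
  \<open>l = 2\<close> serves the second case of the bound on the exponents.\<close>

lemma cyclic_reversible_code:
  assumes p: "Factorial_Ring.prime p" and l: "Factorial_Ring.prime l" and "p \<noteq> l"
  obtains U d where "card U = p ^ d" "1 \<le> d" "d \<le> nu (ord l p) * ord l p" "l = 2 \<Longrightarrow> d = 1"
    "U \<subseteq> cyc0 p l" "0 \<in> U" "\<And>v w. v \<in> U \<Longrightarrow> w \<in> U \<Longrightarrow> v + w \<in> U"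
    "\<And>v. v \<in> U \<Longrightarrow> - v \<in> U" "\<And>v c. v \<in> U \<Longrightarrow> (\<lambda>i. v (i + c)) \<in> U"
    "\<And>v. v \<in> U \<Longrightarrow> v \<noteq> 0 \<Longrightarrow> \<exists>w\<in>U. (\<Sum>i<l. v (int i) * w (int i)) \<noteq> 0"
proof -
  have pl: "p > 0" "l > 0" using p l by (simp_all add: prime_gt_0_nat)
  define k where "k = ord l p"
  have "coprime l p" using p l \<open>p \<noteq> l\<close> by (simp add: primes_coprime)
  then have k0: "k > 0" by (simp add: k_def)
  have kc: "[p ^ k = 1] (mod l)" unfolding k_def by (rule ord)
  obtain v where v: "v \<in> cyc0 p l" "v \<noteq> (\<lambda>i. 0)"
    and simple: "\<And>f. act 1 f v \<noteq> (\<lambda>i. 0) \<Longrightarrow> \<exists>g. act 1 (g * f) v = v"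
    using cyc0_cyclic_simple[OF p l] by blast
  have vc: "v \<in> cyc p l" using v(1) by (rule cyc0_subset)
  define V where "V = range (\<lambda>f. act 1 f v)"
  have cardV: "card V \<le> p ^ k"
    unfolding V_def by (rule card_simple_orbit_le[OF p l v simple kc k0])
  have V0: "V \<subseteq> cyc0 p l" using act_in_cyc0[OF pl(2) v(1)] by (auto simp: V_def)
  have V_zero: "0 \<in> V" by (auto simp: V_def zero_fun_def intro!: image_eqI[of _ _ 0])
  have V_add: "a + b \<in> V" if "a \<in> V" "b \<in> V" for a b
    using that by (auto simp: V_def plus_fun_def simp flip: act_add_left)
  have V_minus: "- a \<in> V" if "a \<in> V" for a
    using that by (auto simp: V_def fun_Compl_def simp flip: act_uminus_left)
  have V_shift: "(\<lambda>i. a (i + c)) \<in> V" if a: "a \<in> V" for a c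
  proof -
    obtain f where f: "a = act 1 f v" using a by (auto simp: V_def)
    \<comment> \<open>Polynomials produce only nonnegative shifts, so \<open>c\<close> is first
      reduced modulo \<open>l\<close>.\<close>
    define j where "j = nat (c mod int l)"
    have "[i + int j = i + c] (mod int l)" for i
      using pl by (intro cong_add cong_refl) (simp add: j_def)
    then have "(\<lambda>i. a (i + c)) = (\<lambda>i. a (i + int j))"
      using a V0 by (intro ext cyc_cong[of a p l]) (auto simp: cyc0_def cong_sym)
    also have "\<dots> = act 1 (Polynomial.monom 1 j * f) v"
      by (simp add: act_mult act_monom f)
    finally show ?thesis by (simp add: V_def)
  qed
  define U where "U = (\<lambda>(a, b) i. a i + b (- i)) ` (V \<times> V)"
  have UI: "(\<lambda>i. a i + b (- i)) \<in> U" if "a \<in> V" "b \<in> V" for a b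
    using that by (auto simp: U_def)
  have UE: "\<exists>a\<in>V. \<exists>b\<in>V. u = (\<lambda>i. a i + b (- i))" if "u \<in> U" for u
    using that by (auto simp: U_def)
  have finV: "finite V"
    by (rule finite_subset[OF _ finite_cyc[OF pl]]) (use V0 cyc0_subset in blast)
  then have finU: "finite U" by (simp add: U_def)
  have rev0: "(\<lambda>i. a (- i)) \<in> cyc0 p l" if "a \<in> cyc0 p l" for a
  proof -
    have a: "a \<in> cyc p l" using that by (rule cyc0_subset)
    have "(\<lambda>i. a (- i)) \<in> cyc p l"
      using cyc_gf[OF a] by (auto simp: cyc_def intro!: cyc_cong[OF a] simp: cong_iff_dvd_diff)
    moreover have "(\<Sum>i<l. a (- int i)) = (\<Sum>i<l. a (int i))"
      using pl a by (intro sum_periodic_reverse) (auto simp: cyc_def)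
    ultimately show ?thesis using that by (simp add: cyc0_def)
  qed
  have add0: "(\<lambda>i. a i + b i) \<in> cyc0 p l" if "a \<in> cyc0 p l" "b \<in> cyc0 p l" for a b
    using that by (auto simp: cyc0_def cyc_def sum.distrib)
  have U0: "U \<subseteq> cyc0 p l"
    using UE V0 rev0 add0 by fast
  have U_zero: "0 \<in> U"
    using UI[OF V_zero V_zero] by (simp add: zero_fun_def)
  have U_add: "u + w \<in> U" if uw: "u \<in> U" "w \<in> U" for u w
  proof -
    obtain a b c d where "a \<in> V" "b \<in> V" "c \<in> V" "d \<in> V"
      "u = (\<lambda>i. a i + b (- i))" "w = (\<lambda>i. c i + d (- i))"
      using UE[OF uw(1)] UE[OF uw(2)] by blast
    then show ?thesis
      using UI[OF V_add V_add, of a c b d] by (simp add: plus_fun_def add_ac)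
  qed
  have U_minus: "- u \<in> U" if u: "u \<in> U" for u
  proof -
    obtain a b where "a \<in> V" "b \<in> V" "u = (\<lambda>i. a i + b (- i))" using UE[OF u] by blast
    then show ?thesis
      using UI[OF V_minus V_minus, of a b] by (simp add: fun_Compl_def)
  qed
  have U_shift: "(\<lambda>i. u (i + c)) \<in> U" if u: "u \<in> U" for u c
  proof -
    obtain a b where "a \<in> V" "b \<in> V" "u = (\<lambda>i. a i + b (- i))" using UE[OF u] by blast
    then show ?thesis
      using UI[OF V_shift V_shift, of a b c "- c"] by (simp add: algebra_simps)
  qed
  have U_rev: "(\<lambda>i. u (- i)) \<in> U" if u: "u \<in> U" for u
  proof -
    obtain a b where "a \<in> V" "b \<in> V" "u = (\<lambda>i. a i + b (- i))" using UE[OF u] by blast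
    then show ?thesis
      using UI[of b a] by (simp add: add.commute)
  qed
  have nondeg: "\<exists>w\<in>U. (\<Sum>i<l. u (int i) * w (int i)) \<noteq> 0" if u: "u \<in> U" "u \<noteq> 0" for u
  proof -
    have uc: "u \<in> cyc p l" using u(1) U0 cyc0_subset by blast
    have "act 1 (poly_of p l u) u \<noteq> (\<lambda>i. 0)"
      using u(2) by (intro convolution_square_nonzero[OF p l \<open>p \<noteq> l\<close> uc]) (simp add: zero_fun_def)
    \<comment> \<open>Coordinate \<open>m\<close> of the convolution square is the dot product of
      \<open>u\<close> with \<open>\<lambda>i. u (m - i)\<close>, which lies in
      \<open>U\<close>.\<close>
    then obtain m where m: "(\<Sum>j<l. u (- int j) * u (m + int j)) \<noteq> 0"
      by (auto simp: fun_eq_iff act_poly_of[OF uc uc])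
    have "(\<Sum>j<l. u (- int j) * u (m - (- int j))) = (\<Sum>j<l. u (int j) * u (m - int j))"
      using pl uc by (intro sum_periodic_reverse) (auto intro!: arg_cong2[of _ _ _ _ "(*)"] cyc_cong[OF uc] simp: cong_iff_dvd_diff)
    moreover have "(\<lambda>i. u (m - i)) \<in> U"
      using U_shift[OF U_rev[OF u(1)], of "- m"] by (simp add: algebra_simps)
    ultimately show ?thesis using m by (intro bexI[of _ "\<lambda>i. u (m - i)"]) auto
  qed
  have expo: "((+) u ^^ p) 0 = 0" if "u \<in> U" for u
  proof
    fix i
    have "u i \<in> gf p" using that U0 cyc0_subset cyc_gf by blast
    then show "((+) u ^^ p) 0 i = 0 i"
      using gf_char[of "u i" p 1] by (simp add: funpow_add_apply)
  qed
  obtain d where d: "card U = p ^ d"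
    using card_elementary_abelian[OF p finU U_zero U_add U_minus expo] by blast
  have p1: "p > 1" using p by (rule prime_gt_1_nat)
  have "v \<in> V" by (auto simp: V_def intro!: image_eqI[of _ _ 1])
  then have "v \<in> U" using UI[of v 0] V_zero by simp
  then have "card {0, v} \<le> card U" using U_zero finU by (intro card_mono) auto
  then have d1: "d \<ge> 1" using d v(2) by (cases d) (auto simp: zero_fun_def)
  have d2: "d \<le> nu k * k"
  proof (cases "even k")
    case False
    have "card U \<le> card (V \<times> V)" unfolding U_def using finV by (intro card_image_le) simp
    also have "\<dots> \<le> p ^ k * p ^ k" unfolding card_cartesian_product by (intro mult_le_mono cardV)
    finally show ?thesis using d p1 False by (simp add: nu_def mult_2 flip: power_add)
  next
    case True
    then obtain h where h: "k = 2 * h" by blast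
    \<comment> \<open>Here \<open>p ^ h\<close> is \<open>-1\<close> modulo \<open>l\<close>, so reversal is a power of the Frobenius map and \<open>U = V\<close>.\<close>
    have "[(int p ^ h) ^ 2 = 1] (mod int l)"
      using kc by (metis cong_int_iff h of_nat_1 of_nat_power power_mult mult.commute)
    then have "int l dvd (int p ^ h - 1) * (int p ^ h + 1)"
      by (simp add: cong_iff_dvd_diff power2_eq_square algebra_simps)
    \<comment> \<open>As \<open>h < k\<close>, minimality of the order excludes the square root
      1.\<close>
    moreover have "\<not> int l dvd int p ^ h - 1"
    proof
      assume "int l dvd int p ^ h - 1"
      then have "[p ^ h = 1] (mod l)"
        by (metis cong_iff_dvd_diff cong_int_iff of_nat_1 of_nat_power)
      then show False using ord_minimal[of h l p] h k0 by (simp add: k_def)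
    qed
    ultimately have "int l dvd int p ^ h + 1"
      using l prime_dvd_mult_iff by (metis prime_nat_int_transfer)
    then have c: "[int (p ^ h) = - 1] (mod int l)" by (simp add: cong_iff_dvd_diff)
    have "(\<lambda>i. act 1 g v (- i)) \<in> V" for g
    proof -
      \<comment> \<open>\<open>delta\<close> is symmetric, so reversal replaces stride 1 by -1, that
        is, by \<open>p ^ h\<close>. The resulting power of \<open>g * f0\<close> keeps a factor
        \<open>f0\<close>, which sends \<open>delta\<close> to \<open>v\<close>.\<close>
      define f0 where "f0 = poly_of p l v"
      have f0: "act 1 f0 (delta p l) = v" using act_poly_of_delta[OF pl(2) vc] by (simp add: f0_def)
      have "delta p l (- i) = delta p l i" for i by (simp add: delta_def)
      then have "(\<lambda>i. act 1 (g * f0) (delta p l) (- i)) = act (-1) (g * f0) (delta p l)"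
        using act_reverse[of "-1" "g * f0" "delta p l"] by simp
      also have "\<dots> = act (1 * int (p ^ h)) (g * f0) (delta p l)"
        using c by (intro act_stride_cong[OF delta_in_cyc]) (simp add: cong_sym)
      also have "\<dots> = act 1 ((g * f0) ^ (p ^ h)) (delta p l)"
        by (rule act_frobenius_power[OF p delta_in_cyc, symmetric])
      also have "(g * f0) ^ (p ^ h) = g ^ (p ^ h) * f0 ^ (p ^ h - 1) * f0"
        using pl by (simp add: power_mult_distrib mult.assoc flip: power_Suc2)
      finally show ?thesis by (simp add: act_mult f0 V_def flip: mult.assoc) (metis act_mult rangeI)
    qed
    then have "U \<subseteq> V"
      using V_add by (fastforce simp: U_def V_def plus_fun_def)
    then have "card U \<le> p ^ k" using cardV card_mono[OF finV] le_trans by blast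
    then show ?thesis using d p1 True by (simp add: nu_def)
  qed
  have d3: "d = 1" if "l = 2"
  proof -
    \<comment> \<open>A sequence of period 2 with zero sum is determined by its value at 0.\<close>
    have "inj_on (\<lambda>u. u 0) U"
    proof (rule inj_onI)
      fix u w assume "u \<in> U" "w \<in> U" and eq: "u 0 = w 0"
      then have uw: "u \<in> cyc0 p 2" "w \<in> cyc0 p 2" using U0 that by auto
      then have "u 0 + u 1 = 0" "w 0 + w 1 = 0" by (auto simp: cyc0_def numeral_2_eq_2)
      then have "u 1 = w 1" using eq by (metis add_left_cancel)
      have "u i = w i" for i
      proof -
        have "u i = u (i mod 2)" "w i = w (i mod 2)"
          using uw by (auto intro!: cyc_cong[of _ p 2] simp: cyc0_def)
        moreover have "i mod 2 = 0 \<or> i mod 2 = 1" by auto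
        ultimately show ?thesis using eq \<open>u 1 = w 1\<close> by auto
      qed
      then show "u = w" by blast
    qed
    moreover have "(\<lambda>u. u 0) ` U \<subseteq> gf p" using U0 cyc0_subset cyc_gf by blast
    ultimately have "card U \<le> card (gf p)" using finite_gf[OF pl(1)] by (metis card_inj_on_le)
    then have "p ^ d \<le> p ^ 1" using card_gf[OF pl(1)] d by simp
    then have "d \<le> 1" using p1 by (metis power_increasing_iff)
    with \<open>d \<ge> 1\<close> show ?thesis by simp
  qed
  show ?thesis
    by (rule that[of U d];
        (rule d d1 d2[unfolded k_def] d3 U0 U_zero U_add U_minus U_shift nondeg; assumption))
qed

text \<open>Since \<open>l\<close> is prime, multiples of \<open>c\<close> reach every residue, so
  \<open>v\<close> is constant. Its zero sum is \<open>l\<close> times that constant, and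
  \<open>l\<close> is invertible modulo \<open>p\<close>.\<close>

lemma cyc0_shift_fixed:
  assumes p: "Factorial_Ring.prime p" and l: "Factorial_Ring.prime l" and "p \<noteq> l"
    and v: "v \<in> cyc0 p l" and c: "\<not> int l dvd c" and fixed: "\<And>i. v (i + c) = v i"
  shows "v = 0"
proof -
  have vc: "v \<in> cyc p l" using v by (rule cyc0_subset)
  have "coprime c (int l)"
    using c l prime_imp_coprime[of "int l" c] by (simp add: coprime_commute)
  then obtain e where e: "[c * e = 1] (mod int l)" using cong_solve_coprime_int by blast
  have mult: "v (i + c * int n) = v i" for i n
  proof (induction n)
    case (Suc n)
    then show ?case using fixed[of "i + c * int n"] by (simp add: algebra_simps)
  qed simp
  have const: "v i = v 0" for i
  proof -
    have "[0 + c * int (nat ((e * i) mod int l)) = c * (e * i)] (mod int l)"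
      using prime_gt_0_nat[OF l] by (simp add: cong_def mod_mult_right_eq)
    also have "[c * (e * i) = 1 * i] (mod int l)"
      unfolding mult.assoc[symmetric] by (rule cong_mult[OF e cong_refl])
    finally show ?thesis using mult[of 0] cyc_cong[OF vc] by (metis mult_1)
  qed
  have "(\<Sum>i<l. v (int i)) = (\<Sum>i<l. v 0)" by (intro sum.cong refl const)
  then have "of_nat l * v 0 = 0" using v by (simp add: cyc0_def)
  moreover obtain m where m: "v 0 = of_int m * idem p" using cyc_gf[OF vc, of 0] by (auto simp: gf_def)
  ultimately have "of_int (int l * m) * idem p = 0" by (simp add: mult.assoc)
  then have "int p dvd int l * m" by (simp only: of_int_mult_idem_eq_0_iff)
  moreover have "\<not> int p dvd int l"
    using p l \<open>p \<noteq> l\<close> primes_dvd_imp_eq by auto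
  ultimately have "int p dvd m" using p by (simp add: prime_dvd_mult_iff)
  then have "v 0 = 0" by (simp add: m of_int_mult_idem_eq_0_iff)
  then show ?thesis using const by (simp add: fun_eq_iff)
qed

section \<open>Asymmetric products\<close>

text \<open>The one-step criterion for an additive subgroup.\<close>

definition diff_closed :: "'a :: ab_group_add set \<Rightarrow> bool" where
  "diff_closed K \<longleftrightarrow> 0 \<in> K \<and> (\<forall>x\<in>K. \<forall>y\<in>K. x - y \<in> K)"

lemma diff_closed_0: "diff_closed K \<Longrightarrow> 0 \<in> K"
  by (simp add: diff_closed_def)

lemma diff_closed_diff: "diff_closed K \<Longrightarrow> x \<in> K \<Longrightarrow> y \<in> K \<Longrightarrow> x - y \<in> K"
  by (simp add: diff_closed_def)

lemma diff_closed_minus: "diff_closed K \<Longrightarrow> x \<in> K \<Longrightarrow> - x \<in> K"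
  by (metis diff_0 diff_closed_0 diff_closed_diff)

lemma diff_closed_add: "diff_closed K \<Longrightarrow> x \<in> K \<Longrightarrow> y \<in> K \<Longrightarrow> x + y \<in> K"
  by (metis diff_minus_eq_add diff_closed_diff diff_closed_minus)

text \<open>Evaluates the definite description in \<open>add_grp\<close> and \<open>mul_grp\<close>;
  the right identity law gives uniqueness.\<close>

lemma the_left_identity:
  assumes "z \<in> B" "\<And>x. x \<in> B \<Longrightarrow> f z x = x" "\<And>x. x \<in> B \<Longrightarrow> f x z = x"
  shows "(THE z. z \<in> B \<and> (\<forall>x\<in>B. f z x = x)) = z"
proof (rule the_equality)
  show "z \<in> B \<and> (\<forall>x\<in>B. f z x = x)" using assms by blast
  fix y assume "y \<in> B \<and> (\<forall>x\<in>B. f y x = x)"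
  then show "y = z" using assms(1) assms(3)[of y] by auto
qed

text \<open>The multiplicative group is the semidirect product of \<open>S\<close> and \<open>T\<close>, the additive group the
  extension of \<open>S\<close> by \<open>T\<close> with cocycle \<open>b\<close>; \<open>KS\<close> and \<open>KT\<close> stand for the intersections of an ideal
  with the two factors.\<close>

locale asymmetric_product =
  fixes S :: "'s :: ab_group_add set" and T :: "'t :: ab_group_add set"
    and tau :: "'t \<Rightarrow> 's \<Rightarrow> 's" and b :: "'s \<Rightarrow> 's \<Rightarrow> 't"
  assumes fin: "finite S" "finite T"
    and sub: "diff_closed S" "diff_closed T"
    and T_nontrivial: "T \<noteq> {0}"
    and tau_closed: "t \<in> T \<Longrightarrow> s \<in> S \<Longrightarrow> tau t s \<in> S"
    and tau_diff: "t \<in> T \<Longrightarrow> s \<in> S \<Longrightarrow> s' \<in> S \<Longrightarrow> tau t (s - s') = tau t s - tau t s'"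
    and tau_zero: "s \<in> S \<Longrightarrow> tau 0 s = s"
    and tau_plus: "t \<in> T \<Longrightarrow> t' \<in> T \<Longrightarrow> s \<in> S \<Longrightarrow> tau (t + t') s = tau t (tau t' s)"
    and b_closed: "s \<in> S \<Longrightarrow> s' \<in> S \<Longrightarrow> b s s' \<in> T"
    and b_commute: "s \<in> S \<Longrightarrow> s' \<in> S \<Longrightarrow> b s s' = b s' s"
    and b_diff: "s \<in> S \<Longrightarrow> s' \<in> S \<Longrightarrow> r \<in> S \<Longrightarrow> b (s - s') r = b s r - b s' r"
    and b_tau: "t \<in> T \<Longrightarrow> s \<in> S \<Longrightarrow> s' \<in> S \<Longrightarrow> b (tau t s) (tau t s') = b s s'"
    and b_nondegenerate: "s \<in> S \<Longrightarrow> s \<noteq> 0 \<Longrightarrow> \<exists>r\<in>S. b s r \<noteq> 0"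
    and full: "KS \<subseteq> S \<Longrightarrow> KT \<subseteq> T \<Longrightarrow> diff_closed KS \<Longrightarrow> diff_closed KT \<Longrightarrow> KT \<noteq> {0} \<Longrightarrow>
      (\<And>t s. t \<in> KT \<Longrightarrow> s \<in> S \<Longrightarrow> s - tau t s \<in> KS) \<Longrightarrow>
      (\<And>s r. s \<in> KS \<Longrightarrow> r \<in> S \<Longrightarrow> b s r \<in> KT) \<Longrightarrow> KS = S \<and> KT = T"
    and coprime_action: "Factorial_Ring.prime q \<Longrightarrow> s \<in> S \<Longrightarrow> s' \<in> S \<Longrightarrow> t \<in> T \<Longrightarrow> t' \<in> T \<Longrightarrow>
      ((+) t ^^ (q ^ k)) 0 = 0 \<Longrightarrow> ((+) t' ^^ (q ^ k)) 0 = 0 \<Longrightarrow>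
      ((+) (s + tau t s' - (s' + tau t' s)) ^^ (q ^ k)) 0 = 0 \<Longrightarrow>
      s + tau t s' = s' + tau t' s"
begin

lemmas S_closed [simp] = diff_closed_0[OF sub(1)] diff_closed_diff[OF sub(1)] diff_closed_minus[OF sub(1)] diff_closed_add[OF sub(1)]
lemmas T_closed [simp] = diff_closed_0[OF sub(2)] diff_closed_diff[OF sub(2)] diff_closed_minus[OF sub(2)] diff_closed_add[OF sub(2)]

declare tau_closed [simp] tau_diff [simp] tau_zero [simp] b_closed [simp] b_diff [simp] b_tau [simp]

lemma tau_0_right [simp]: "t \<in> T \<Longrightarrow> tau t 0 = 0"
  using tau_diff[of t 0 0] by simp

lemma tau_minus [simp]: "t \<in> T \<Longrightarrow> s \<in> S \<Longrightarrow> tau t (- s) = - tau t s"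
  using tau_diff[of t 0 s] by simp

lemma tau_add [simp]: "t \<in> T \<Longrightarrow> s \<in> S \<Longrightarrow> s' \<in> S \<Longrightarrow> tau t (s + s') = tau t s + tau t s'"
  using tau_diff[of t s "- s'"] by simp

lemma tau_cancel [simp]:
  "t \<in> T \<Longrightarrow> s \<in> S \<Longrightarrow> tau t (tau (- t) s) = s"
  "t \<in> T \<Longrightarrow> s \<in> S \<Longrightarrow> tau (- t) (tau t s) = s"
  by (simp_all flip: tau_plus)

lemma b_0_left [simp]: "r \<in> S \<Longrightarrow> b 0 r = 0"
  using b_diff[of 0 0 r] by simp

lemma b_minus_left [simp]: "s \<in> S \<Longrightarrow> r \<in> S \<Longrightarrow> b (- s) r = - b s r"
  using b_diff[of 0 s r] by simp

lemma b_add_left [simp]: "s \<in> S \<Longrightarrow> s' \<in> S \<Longrightarrow> r \<in> S \<Longrightarrow> b (s + s') r = b s r + b s' r"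
  using b_diff[of s "- s'" r] by simp

lemma b_right [simp]:
  "r \<in> S \<Longrightarrow> b r 0 = 0"
  "s \<in> S \<Longrightarrow> r \<in> S \<Longrightarrow> b r (- s) = - b r s"
  "s \<in> S \<Longrightarrow> s' \<in> S \<Longrightarrow> r \<in> S \<Longrightarrow> b r (s + s') = b r s + b r s'"
  by (simp_all add: b_commute[of r])

text \<open>Simplicity rests on \<open>b_nondegenerate\<close> and \<open>full\<close>, while
  \<open>coprime_action\<close> makes the elements of a Sylow subgroup commute. Pairs are renamed as
  natural numbers to fit the carrier type.\<close>

lemma asymmetric_product_brace:
  "\<exists>(B :: nat set) ad mu. finite B \<and> simple_brace B ad mu \<and> card B = card S * card T \<and>
     metabelian (mul_grp B mu) \<and> sylow_abelian (mul_grp B mu)"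
proof -
  define N where "N = card S * card T"
  have "finite (S \<times> T)" using fin by simp
  then obtain e where e: "bij_betw e (S \<times> T) {..<N}"
    unfolding N_def using ex_bij_betw_finite_nat[of "S \<times> T"] by (auto simp: card_cartesian_product lessThan_atLeast0)
  define B where "B = {..<N}"
  define E where "E s t = e (s, t)" for s t
  define d where "d = inv_into (S \<times> T) e"
  have dE: "d (E s t) = (s, t)" if "s \<in> S" "t \<in> T" for s t
    using that e by (simp add: d_def E_def bij_betw_inv_into_left)
  define ad where "ad x y = (case (d x, d y) of ((s, t), (s', t')) \<Rightarrow> E (s + s') (t + t' + b s s'))" for x y
  define mu where "mu x y = (case (d x, d y) of ((s, t), (s', t')) \<Rightarrow> E (s + tau t s') (t + t'))" for x y
  have ad [simp]: "ad (E s t) (E s' t') = E (s + s') (t + t' + b s s')"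
    if "s \<in> S" "t \<in> T" "s' \<in> S" "t' \<in> T" for s t s' t'
    using that by (simp add: ad_def dE)
  have mu [simp]: "mu (E s t) (E s' t') = E (s + tau t s') (t + t')"
    if "s \<in> S" "t \<in> T" "s' \<in> S" "t' \<in> T" for s t s' t'
    using that by (simp add: mu_def dE)
  have E_inject [simp]: "E s t = E s' t' \<longleftrightarrow> s = s' \<and> t = t'"
    if "s \<in> S" "t \<in> T" "s' \<in> S" "t' \<in> T" for s t s' t'
    using dE that by (metis prod.inject)
  have EB [simp]: "E s t \<in> B" if "s \<in> S" "t \<in> T" for s t
    using that bij_betwE[OF e] by (simp add: E_def B_def)
  have B_E: "\<exists>s\<in>S. \<exists>t\<in>T. x = E s t" if "x \<in> B" for x
  proof -
    have "x \<in> e ` (S \<times> T)" using that bij_betw_imp_surj_on[OF e] by (simp add: B_def)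
    then show ?thesis by (auto simp: E_def)
  qed
  define A where "A = add_grp B ad"
  define M where "M = mul_grp B mu"
  have "(THE z. z \<in> B \<and> (\<forall>x\<in>B. ad z x = x)) = E 0 0"
    by (rule the_left_identity) (auto dest!: B_E)
  then have A [simp]: "carrier A = B" "x \<otimes>\<^bsub>A\<^esub> y = ad x y" "\<one>\<^bsub>A\<^esub> = E 0 0" for x y
    by (simp_all add: A_def add_grp_def)
  have "(THE z. z \<in> B \<and> (\<forall>x\<in>B. mu z x = x)) = E 0 0"
    by (rule the_left_identity) (auto dest!: B_E)
  then have M [simp]: "carrier M = B" "x \<otimes>\<^bsub>M\<^esub> y = mu x y" "\<one>\<^bsub>M\<^esub> = E 0 0" for x y
    by (simp_all add: M_def mul_grp_def)
  have A_group: "comm_group A"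
  proof (rule comm_groupI)
    fix x y z assume "x \<in> carrier A" "y \<in> carrier A" "z \<in> carrier A"
    then obtain s t s' t' s'' t'' where
      *: "s \<in> S" "t \<in> T" "x = E s t" "s' \<in> S" "t' \<in> T" "y = E s' t'" "s'' \<in> S" "t'' \<in> T" "z = E s'' t''"
      using B_E by (metis A(1))
    then show "(x \<otimes>\<^bsub>A\<^esub> y) \<otimes>\<^bsub>A\<^esub> z = x \<otimes>\<^bsub>A\<^esub> (y \<otimes>\<^bsub>A\<^esub> z)" by (simp add: algebra_simps)
  next
    fix x y assume "x \<in> carrier A" "y \<in> carrier A"
    then obtain s t s' t' where *: "s \<in> S" "t \<in> T" "x = E s t" "s' \<in> S" "t' \<in> T" "y = E s' t'"
      using B_E by (metis A(1))
    then show "x \<otimes>\<^bsub>A\<^esub> y \<in> carrier A" by simp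
    show "x \<otimes>\<^bsub>A\<^esub> y = y \<otimes>\<^bsub>A\<^esub> x" using * by (simp add: add_ac b_commute)
  next
    fix x assume "x \<in> carrier A"
    then obtain s t where *: "s \<in> S" "t \<in> T" "x = E s t" using B_E by (metis A(1))
    then show "\<one>\<^bsub>A\<^esub> \<otimes>\<^bsub>A\<^esub> x = x" by simp
    show "\<exists>y\<in>carrier A. y \<otimes>\<^bsub>A\<^esub> x = \<one>\<^bsub>A\<^esub>"
      \<comment> \<open>The term \<open>b s s\<close> cancels the cocycle value
        \<open>b (- s) s\<close>.\<close>
      using * by (intro bexI[of _ "E (- s) (- t + b s s)"]) simp_all
  qed simp
  then interpret A: comm_group A .
  have M_group: "group M"
  proof (rule groupI)
    fix x y z assume "x \<in> carrier M" "y \<in> carrier M" "z \<in> carrier M"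
    then obtain s t s' t' s'' t'' where
      *: "s \<in> S" "t \<in> T" "x = E s t" "s' \<in> S" "t' \<in> T" "y = E s' t'" "s'' \<in> S" "t'' \<in> T" "z = E s'' t''"
      using B_E by (metis M(1))
    then show "(x \<otimes>\<^bsub>M\<^esub> y) \<otimes>\<^bsub>M\<^esub> z = x \<otimes>\<^bsub>M\<^esub> (y \<otimes>\<^bsub>M\<^esub> z)" by (simp add: add.assoc tau_plus)
  next
    fix x y assume "x \<in> carrier M" "y \<in> carrier M"
    then obtain s t s' t' where *: "s \<in> S" "t \<in> T" "x = E s t" "s' \<in> S" "t' \<in> T" "y = E s' t'"
      using B_E by (metis M(1))
    then show "x \<otimes>\<^bsub>M\<^esub> y \<in> carrier M" by simp
  next
    fix x assume "x \<in> carrier M"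
    then obtain s t where *: "s \<in> S" "t \<in> T" "x = E s t" using B_E by (metis M(1))
    then show "\<one>\<^bsub>M\<^esub> \<otimes>\<^bsub>M\<^esub> x = x" by simp
    show "\<exists>y\<in>carrier M. y \<otimes>\<^bsub>M\<^esub> x = \<one>\<^bsub>M\<^esub>"
      using * by (intro bexI[of _ "E (- tau (- t) s) (- t)"]) simp_all
  qed simp
  then interpret M: group M .
  have invA [simp]: "inv\<^bsub>A\<^esub> E s t = E (- s) (- t + b s s)" if "s \<in> S" "t \<in> T" for s t
    using that by (intro A.inv_equality) simp_all
  have invM [simp]: "inv\<^bsub>M\<^esub> E s t = E (- tau (- t) s) (- t)" if "s \<in> S" "t \<in> T" for s t
    using that by (intro M.inv_equality) simp_all
  have "left_brace B ad mu"
    unfolding left_brace_def A_def[symmetric] M_def[symmetric]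
  proof (intro conjI A_group M_group ballI)
    fix x y z assume "x \<in> B" "y \<in> B" "z \<in> B"
    then obtain s t s' t' s'' t'' where
      *: "s \<in> S" "t \<in> T" "x = E s t" "s' \<in> S" "t' \<in> T" "y = E s' t'" "s'' \<in> S" "t'' \<in> T" "z = E s'' t''"
      using B_E by metis
    then have "b s (tau t s') = b (tau t s') s" by (intro b_commute) simp_all
    with * show "ad (mu x (ad y z)) x = ad (mu x y) (mu x z)" by (simp add: algebra_simps b_commute)
  qed
  have lam: "brace_lambda B ad mu (E s t) (E s' t') = E (tau t s') (t' - b s (tau t s'))"
    if "s \<in> S" "t \<in> T" "s' \<in> S" "t' \<in> T" for s t s' t'
    using that by (simp add: brace_lambda_def flip: A_def) (simp add: algebra_simps b_commute)
  have simple: "I = {E 0 0} \<or> I = B" if I: "brace_ideal B ad mu I" for I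
  proof (rule disjCI)
    assume "I \<noteq> B"
    have I_lam: "\<And>x y. x \<in> B \<Longrightarrow> y \<in> I \<Longrightarrow> brace_lambda B ad mu x y \<in> I"
      and IM: "normal I M"
      using I by (auto simp: brace_ideal_def left_ideal_def A_def M_def)
    interpret IM: normal I M by (rule IM)
    have I_mu: "mu x y \<in> I" if "x \<in> I" "y \<in> I" for x y
      using IM.m_closed[OF that] by simp
    have I_inv: "inv\<^bsub>M\<^esub> x \<in> I" if "x \<in> I" for x
      using that by (rule IM.m_inv_closed)
    have IB: "I \<subseteq> B" using IM.subset by simp
    define KS where "KS = {s \<in> S. E s 0 \<in> I}"
    define KT where "KT = {t \<in> T. E 0 t \<in> I}"
    have E00: "E 0 0 \<in> I" using IM.one_closed by simp
    have "diff_closed KS"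
      unfolding diff_closed_def
    proof (intro conjI ballI)
      fix x y assume "x \<in> KS" "y \<in> KS"
      then show "x - y \<in> KS"
        using I_mu[of "E x 0" "inv\<^bsub>M\<^esub> E y 0"] I_inv[of "E y 0"] by (simp add: KS_def)
    qed (simp add: KS_def E00)
    moreover have KT: "diff_closed KT"
      unfolding diff_closed_def
    proof (intro conjI ballI)
      fix x y assume "x \<in> KT" "y \<in> KT"
      then show "x - y \<in> KT"
        using I_mu[of "E 0 x" "inv\<^bsub>M\<^esub> E 0 y"] I_inv[of "E 0 y"] by (simp add: KT_def)
    qed (simp add: KT_def E00)
    moreover have "s - tau t s \<in> KS" if "t \<in> KT" "s \<in> S" for s t
    proof -
      have t: "t \<in> T" "E 0 t \<in> I" using that by (auto simp: KT_def)
      \<comment> \<open>Conjugating \<open>E 0 t\<close> and then cancelling it leaves the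
        commutator \<open>E (s - tau t s) 0\<close>.\<close>
      have "E s 0 \<otimes>\<^bsub>M\<^esub> E 0 t \<otimes>\<^bsub>M\<^esub> inv\<^bsub>M\<^esub> E s 0 \<in> I"
        using t that(2) by (intro IM.inv_op_closed2) simp_all
      then have "E (s - tau t s) t \<in> I" using t that(2) by simp
      from I_mu[OF this I_inv[OF t(2)]] show ?thesis
        using t that(2) by (simp add: KS_def)
    qed
    moreover have KT_b: "b s r \<in> KT" if "E s t \<in> I" "s \<in> S" "t \<in> T" "r \<in> S" for s t r
    proof -
      \<comment> \<open>This map keeps \<open>s\<close> and subtracts \<open>b r s\<close> from
        \<open>t\<close>; comparison with \<open>E s t\<close> isolates an element of
        \<open>T\<close>. A general \<open>t\<close> is allowed because the ideal need not be a
        product.\<close>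
      have "brace_lambda B ad mu (E r 0) (E s t) \<in> I" using that by (intro I_lam) simp_all
      then have "E s (t - b r s) \<in> I" using that by (simp add: lam)
      from I_mu[OF I_inv[OF that(1)] this] have "- b r s \<in> KT"
        using that by (simp add: KT_def)
      then show ?thesis using diff_closed_minus[OF KT] that b_commute[of r s] by fastforce
    qed
    then have "b s r \<in> KT" if "s \<in> KS" "r \<in> S" for s r
      using that by (auto simp: KS_def)
    moreover have False if ne: "I \<noteq> {E 0 0}" and triv: "KT = {0}"
    proof -
      \<comment> \<open>A nonzero element of the ideal lies in \<open>T\<close> already or, if
        \<open>s\<close> is nonzero, yields some nonzero \<open>b s r\<close> in
        \<open>KT\<close>.\<close>
      obtain x where "x \<in> I" "x \<noteq> E 0 0" using ne E00 by blast
      then obtain s t where x: "s \<in> S" "t \<in> T" "E s t \<in> I" "E s t \<noteq> E 0 0"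
        using B_E IB by (metis subsetD)
      show False
      proof (cases "s = 0")
        case True
        then show ?thesis using x triv by (auto simp: KT_def)
      next
        case False
        then show ?thesis using b_nondegenerate[OF x(1)] KT_b[OF x(3) x(1,2)] triv by auto
      qed
    qed
    moreover have False if "KS = S" "KT = T"
    proof -
      have "x \<in> I" if x: "x \<in> B" for x
      proof -
        obtain s t where x: "s \<in> S" "t \<in> T" "x = E s t" using B_E x by blast
        then have "E s 0 \<in> I" "E 0 t \<in> I" using \<open>KS = S\<close> \<open>KT = T\<close> by (auto simp: KS_def KT_def)
        from I_mu[OF this] show ?thesis using x by simp
      qed
      then show False using IB \<open>I \<noteq> B\<close> by blast
    qed
    moreover have "KS \<subseteq> S" "KT \<subseteq> T" by (auto simp: KS_def KT_def)
    ultimately show "I = {E 0 0}"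
      using full[of KS KT] by metis
  qed
  obtain t0 where t0: "t0 \<in> T" "t0 \<noteq> 0" using T_nontrivial T_closed(1) by blast
  then have "E 0 t0 \<in> B" "E 0 t0 \<noteq> E 0 0" by simp_all
  then have "B \<noteq> {E 0 0}" by blast
  then have "simple_brace B ad mu"
    using \<open>left_brace B ad mu\<close> simple by (simp add: simple_brace_def flip: A_def)
  moreover have "metabelian M"
  proof -
    \<comment> \<open>\<open>D\<close> is the copy of \<open>S\<close>: it is abelian, and it
      contains all commutators because \<open>T\<close> is abelian.\<close>
    define D where "D = (\<lambda>s. E s 0) ` S"
    have "S \<noteq> {}" using S_closed(1) by blast
    then have "subgroup D M"
      by (intro M.subgroupI) (auto simp: D_def)
    moreover have "derived_set M (carrier M) \<subseteq> D"
    proof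
      fix x assume "x \<in> derived_set M (carrier M)"
      then obtain y z where yz: "y \<in> B" "z \<in> B" "x = y \<otimes>\<^bsub>M\<^esub> z \<otimes>\<^bsub>M\<^esub> inv\<^bsub>M\<^esub> y \<otimes>\<^bsub>M\<^esub> inv\<^bsub>M\<^esub> z" by auto
      then obtain s t s' t' where "s \<in> S" "t \<in> T" "y = E s t" "s' \<in> S" "t' \<in> T" "z = E s' t'"
        using B_E by metis
      then show "x \<in> D" using yz(3) by (simp add: D_def)
    qed
    ultimately have D: "derived M (carrier M) \<subseteq> D"
      unfolding derived_def by (rule M.generate_subgroup_incl[rotated])
    have "derived_set M (derived M (carrier M)) \<subseteq> {\<one>\<^bsub>M\<^esub>}"
    proof
      fix x assume "x \<in> derived_set M (derived M (carrier M))"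
      then obtain y z where yz: "y \<in> D" "z \<in> D" "x = y \<otimes>\<^bsub>M\<^esub> z \<otimes>\<^bsub>M\<^esub> inv\<^bsub>M\<^esub> y \<otimes>\<^bsub>M\<^esub> inv\<^bsub>M\<^esub> z"
        using D by auto
      then show "x \<in> {\<one>\<^bsub>M\<^esub>}" by (auto simp: D_def)
    qed
    then have "derived M (derived M (carrier M)) \<subseteq> {\<one>\<^bsub>M\<^esub>}"
      unfolding derived_def[of M "derived M _"] by (rule M.generate_subgroup_incl[OF _ M.triv_subgroup])
    moreover have "\<one>\<^bsub>M\<^esub> \<in> derived M (derived M (carrier M))"
      unfolding derived_def[of M "derived M _"] by (rule generate.one)
    ultimately show ?thesis unfolding metabelian_def by blast
  qed
  moreover have "sylow_abelian M"
    unfolding sylow_abelian_def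
  proof (intro allI impI, elim conjE)
    fix q :: nat and H
    assume q: "Factorial_Ring.prime q" and H: "subgroup H M"
      and cardH: "card H = q ^ multiplicity q (Coset.order M)"
    define n where "n = q ^ multiplicity q (Coset.order M)"
    interpret H: group "M\<lparr>carrier := H\<rparr>" by (rule M.subgroup_imp_group[OF H])
    have HB: "H \<subseteq> B" using subgroup.subset[OF H] by simp
    have pow: "x [^]\<^bsub>M\<^esub> n = \<one>\<^bsub>M\<^esub>" if "x \<in> H" for x
    proof -
      have "x [^]\<^bsub>M\<lparr>carrier := H\<rparr>\<^esub> Coset.order (M\<lparr>carrier := H\<rparr>) = \<one>\<^bsub>M\<lparr>carrier := H\<rparr>\<^esub>"
        using that by (intro H.pow_order_eq_1) auto
      then show ?thesis
        using cardH by (simp add: n_def Coset.order_def flip: M.nat_pow_consistent)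
    qed
    have T_mult: "((+) t ^^ i) 0 \<in> T" if "t \<in> T" for t i
      using that by (induction i) simp_all
    have S_mult: "((+) s ^^ i) 0 \<in> S" if "s \<in> S" for s i
      using that by (induction i) simp_all
    \<comment> \<open>Only the \<open>T\<close>-component of a power matters, so its
      \<open>S\<close>-component is left unspecified.\<close>
    have pow1: "\<exists>r\<in>S. E s t [^]\<^bsub>M\<^esub> (i::nat) = E r (((+) t ^^ i) 0)" if "s \<in> S" "t \<in> T" for s t i
    proof (induction i)
      case 0
      then show ?case by (intro bexI[of _ 0]) simp_all
    next
      case (Suc i)
      then obtain r where "r \<in> S" "E s t [^]\<^bsub>M\<^esub> i = E r (((+) t ^^ i) 0)" by blast
      then show ?case using that T_mult[of t i]
        by (intro bexI[of _ "r + tau (((+) t ^^ i) 0) s"]) (simp_all add: add.commute[of _ t])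
    qed
    have pow2: "E s 0 [^]\<^bsub>M\<^esub> (i::nat) = E (((+) s ^^ i) 0) 0" if "s \<in> S" for s i
      using that S_mult[OF that] by (induction i) (simp_all add: add.commute[of _ s])
    have T_pow: "((+) t ^^ n) 0 = 0" if "E s t \<in> H" "s \<in> S" "t \<in> T" for s t
    proof -
      have "\<exists>r\<in>S. E s t [^]\<^bsub>M\<^esub> n = E r (((+) t ^^ n) 0)"
        by (rule pow1[OF that(2,3)])
      then obtain r where r: "r \<in> S" "E s t [^]\<^bsub>M\<^esub> n = E r (((+) t ^^ n) 0)"
        by blast
      then have "E r (((+) t ^^ n) 0) = E 0 0" using pow[OF that(1)] by simp
      then show ?thesis using r(1) T_mult[OF that(3)] by simp
    qed
    show "comm_group (M\<lparr>carrier := H\<rparr>)"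
    proof (rule H.group_comm_groupI)
      fix x y assume "x \<in> carrier (M\<lparr>carrier := H\<rparr>)" "y \<in> carrier (M\<lparr>carrier := H\<rparr>)"
      then have xy: "x \<in> H" "y \<in> H" by auto
      then obtain s t s' t' where *: "s \<in> S" "t \<in> T" "x = E s t" "s' \<in> S" "t' \<in> T" "y = E s' t'"
        using B_E HB by (metis subsetD)
      \<comment> \<open>The commutator of \<open>x\<close> and \<open>y\<close> is
        \<open>E c 0\<close>. It lies in \<open>H\<close>, so \<open>n\<close> kills
        \<open>c\<close> as it kills \<open>t\<close> and \<open>t'\<close>.\<close>
      define c where "c = s + tau t s' - (s' + tau t' s)"
      have c: "c \<in> S" using * by (simp add: c_def)
      have "x \<otimes>\<^bsub>M\<^esub> y = E c 0 \<otimes>\<^bsub>M\<^esub> (y \<otimes>\<^bsub>M\<^esub> x)"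
        using * c by (simp add: add.commute) (simp add: c_def)
      then have "E c 0 = x \<otimes>\<^bsub>M\<^esub> y \<otimes>\<^bsub>M\<^esub> inv\<^bsub>M\<^esub> (y \<otimes>\<^bsub>M\<^esub> x)"
        using * c by (intro M.inv_solve_right[THEN iffD2]) simp_all
      also have "\<dots> \<in> H"
        using xy by (intro subgroup.m_closed[OF H] subgroup.m_inv_closed[OF H])
      finally have "E (((+) c ^^ n) 0) 0 = E 0 0" using pow pow2[OF c] by (metis M(3))
      then have "((+) c ^^ n) 0 = 0" using S_mult[OF c] by simp
      then have "s + tau t s' = s' + tau t' s"
        using coprime_action[OF q, of s s' t t'] T_pow xy * unfolding n_def c_def by blast
      then show "x \<otimes>\<^bsub>M\<lparr>carrier := H\<rparr>\<^esub> y = y \<otimes>\<^bsub>M\<lparr>carrier := H\<rparr>\<^esub> x"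
        using * by (simp add: add.commute)
    qed
  qed
  moreover have "finite B" "card B = card S * card T" by (simp_all add: B_def N_def)
  ultimately show ?thesis unfolding M_def by blast
qed

end

section \<open>The construction\<close>

text \<open>Values outside \<open>I\<close> are zero rather than undefined, so that pointwise
  addition stays inside the product.\<close>

definition coord_prod :: "'i set \<Rightarrow> ('i \<Rightarrow> 'a :: zero set) \<Rightarrow> ('i \<Rightarrow> 'a) set" where
  "coord_prod I F = {f. \<forall>i. if i \<in> I then f i \<in> F i else f i = 0}"

definition sing :: "'i \<Rightarrow> 'a \<Rightarrow> 'i \<Rightarrow> 'a :: zero" where
  "sing i x = (\<lambda>k. if k = i then x else 0)"

lemma coord_prod_in: "f \<in> coord_prod I F \<Longrightarrow> i \<in> I \<Longrightarrow> f i \<in> F i"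
  by (auto simp: coord_prod_def dest: spec[of _ i])

lemma coord_prod_out: "f \<in> coord_prod I F \<Longrightarrow> i \<notin> I \<Longrightarrow> f i = 0"
  by (auto simp: coord_prod_def dest: spec[of _ i])

lemma bij_betw_coord_prod: "bij_betw (\<lambda>f. restrict f I) (coord_prod I F) (PiE I F)"
  by (rule bij_betwI[where g = "\<lambda>f i. if i \<in> I then f i else 0"])
    (auto simp: coord_prod_def fun_eq_iff PiE_def extensional_def split: if_splits)

lemma card_coord_prod: "finite I \<Longrightarrow> card (coord_prod I F) = (\<Prod>i\<in>I. card (F i))"
  using bij_betw_same_card[OF bij_betw_coord_prod] by (metis card_PiE)

lemma finite_coord_prod: "finite I \<Longrightarrow> (\<And>i. i \<in> I \<Longrightarrow> finite (F i)) \<Longrightarrow> finite (coord_prod I F)"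
  using bij_betw_finite[OF bij_betw_coord_prod] finite_PiE by metis

lemma diff_closed_coord_prod:
  fixes F :: "'i \<Rightarrow> 'a :: ab_group_add set"
  assumes "\<And>i. i \<in> I \<Longrightarrow> diff_closed (F i)"
  shows "diff_closed (coord_prod I F)"
  using assms by (simp add: diff_closed_def coord_prod_def)

lemma sing_in_coord_prod:
  "i \<in> I \<Longrightarrow> x \<in> F i \<Longrightarrow> (\<And>k. k \<in> I \<Longrightarrow> 0 \<in> F k) \<Longrightarrow> sing i x \<in> coord_prod I F"
  by (simp add: sing_def coord_prod_def)

lemma diff_closed_sum:
  "diff_closed K \<Longrightarrow> (\<And>i. i \<in> I \<Longrightarrow> f i \<in> K) \<Longrightarrow> sum f I \<in> K"
  by (induction I rule: infinite_finite_induct) (simp_all add: diff_closed_0 diff_closed_add)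

lemma sum_fun_apply: "sum f I k = (\<Sum>i\<in>I. f i k)"
  by (induction I rule: infinite_finite_induct) simp_all

lemma coord_prod_subset:
  fixes F :: "'i \<Rightarrow> 'a :: ab_group_add set"
  assumes "finite I" "diff_closed K" "\<And>i x. i \<in> I \<Longrightarrow> x \<in> F i \<Longrightarrow> sing i x \<in> K"
  shows "coord_prod I F \<subseteq> K"
proof
  fix f assume f: "f \<in> coord_prod I F"
  have "f k = (\<Sum>i\<in>I. sing i (f i)) k" for k
    using assms(1) coord_prod_out[OF f, of k] by (simp add: sum_fun_apply sing_def)
  then have "f = (\<Sum>i\<in>I. sing i (f i))" by blast
  also have "\<dots> \<in> K"
    using assms coord_prod_in[OF f] by (intro diff_closed_sum) auto
  finally show "f \<in> K" .
qed

lemma diff_closed_of_int_mult: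
  fixes K :: "('i \<Rightarrow> 'a :: comm_ring_1) set"
  assumes "diff_closed K" "x \<in> K"
  shows "(\<lambda>i. of_int c * x i) \<in> K"
proof (induction c rule: int_induct[of _ 0])
  case base
  then show ?case using diff_closed_0[OF assms(1)] by (simp add: zero_fun_def)
next
  case (step1 c)
  then show ?case
    using diff_closed_add[OF assms(1) step1(2) assms(2)] by (simp add: plus_fun_def algebra_simps)
next
  case (step2 c)
  then show ?case
    using diff_closed_diff[OF assms(1) step2(2) assms(2)] by (simp add: fun_diff_def algebra_simps)
qed

text \<open>A power of another prime is a unit modulo \<open>p\<close>.\<close>

lemma gf_prime_power_torsion:
  assumes "Factorial_Ring.prime p" "Factorial_Ring.prime q" "q \<noteq> p" "x \<in> gf p"
    and "of_nat (q ^ k) * x = 0"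
  shows "x = 0"
proof -
  have x: "x = of_int (rep p x) * idem p" using assms(4) by (simp add: of_int_rep)
  have "of_int (int (q ^ k) * rep p x) * idem p = 0"
    using assms(5) of_int_rep[OF assms(4)] by (metis mult.assoc of_int_mult of_int_of_nat_eq)
  then have "int p dvd int (q ^ k) * rep p x" by (simp only: of_int_mult_idem_eq_0_iff)
  moreover have "\<not> int p dvd int (q ^ k)"
    using assms(1-3) primes_dvd_imp_eq prime_dvd_power by (metis int_dvd_int_iff)
  ultimately have "int p dvd rep p x"
    using assms(1) by (metis prime_dvd_mult_iff prime_nat_int_transfer)
  then show ?thesis using rep_eq_0_iff[OF assms(4)] by simp
qed

section \<open>Dot products and the cyclic order of the indices\<close>

definition dot :: "nat \<Rightarrow> (int \<Rightarrow> residues_ring) \<Rightarrow> (int \<Rightarrow> residues_ring) \<Rightarrow> residues_ring" where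
  "dot l v w = (\<Sum>i<l. v (int i) * w (int i))"

lemma dot_commute: "dot l v w = dot l w v"
  by (simp add: dot_def mult.commute)

lemma dot_diff_left: "dot l (v - v') w = dot l v w - dot l v' w"
  by (simp add: dot_def left_diff_distrib sum_subtractf)

lemma dot_0 [simp]: "dot l 0 w = 0" "dot l v 0 = 0"
  by (simp_all add: dot_def)

lemma dot_in_gf: "v \<in> cyc p l \<Longrightarrow> w \<in> cyc p l' \<Longrightarrow> dot l'' v w \<in> gf p"
  by (simp add: dot_def cyc_gf)

lemma dot_shift:
  assumes "l > 0" "v \<in> cyc p l" "w \<in> cyc p l"
  shows "dot l (\<lambda>i. v (i + c)) (\<lambda>i. w (i + c)) = dot l v w"
  unfolding dot_def
  using sum_periodic_shift[OF assms(1), of "\<lambda>i. v i * w i" c] assms(2,3) by (simp add: cyc_def)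

lemma zpred_Suc_mod: "z < n \<Longrightarrow> zpred n (Suc z mod n) = z"
  by (cases "Suc z = n") (auto simp: zpred_def)

lemma zpred_less: "n > 0 \<Longrightarrow> zpred n z < n"
  by (simp add: zpred_def)

lemma zpred_neq: "n > 1 \<Longrightarrow> z < n \<Longrightarrow> zpred n z \<noteq> z"
  by (cases z) (auto simp: zpred_def mod_less)

text \<open>In \<open>r\<close>, the bound by \<open>u z\<close> at \<open>z\<close> itself gives
  enough copies for the form to span the \<open>z\<close>-part of \<open>T\<close>; the bound at
  \<open>zpred n z\<close> gives each coordinate of the preceding part a copy to act on.\<close>

locale cyclic_code_family =
  fixes n :: nat and p :: "nat \<Rightarrow> nat" and U :: "nat \<Rightarrow> (int \<Rightarrow> residues_ring) set"
    and u r :: "nat \<Rightarrow> nat"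
  assumes n: "n > 1"
    and p: "z < n \<Longrightarrow> Factorial_Ring.prime (p z)"
    and inj: "inj_on p {..<n}"
    and U_cyc0: "z < n \<Longrightarrow> U z \<subseteq> cyc0 (p z) (p (zpred n z))"
    and U_diff: "z < n \<Longrightarrow> diff_closed (U z)"
    and U_shift: "z < n \<Longrightarrow> v \<in> U z \<Longrightarrow> (\<lambda>i. v (i + c)) \<in> U z"
    and U_nontrivial: "z < n \<Longrightarrow> U z \<noteq> {0}"
    and U_nondegenerate: "z < n \<Longrightarrow> v \<in> U z \<Longrightarrow> v \<noteq> 0 \<Longrightarrow> \<exists>w\<in>U z. dot (p (zpred n z)) v w \<noteq> 0"
    and r: "z < n \<Longrightarrow> 0 < r z" "z < n \<Longrightarrow> r z \<le> u z" "z < n \<Longrightarrow> r (zpred n z) \<le> u z"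
begin

abbreviation "prv \<equiv> zpred n"

definition "SI = Sigma {..<n} (\<lambda>z. {..<u z})"
definition "TI = Sigma {..<n} (\<lambda>z. {..<r z})"
definition "SS = coord_prod SI (\<lambda>k. U (fst k))"
definition "TT = coord_prod TI (\<lambda>k. gf (p (fst k)))"
text \<open>Copy \<open>j\<close> of \<open>U z\<close> is shifted by coordinate \<open>sigma z j\<close> of the \<open>prv z\<close>-part of \<open>T\<close>; since
  \<open>r (prv z) \<le> u z\<close>, each of its coordinates acts nontrivially. All entries of the
  matrix \<open>mat\<close> in row and column \<open>0\<close> are \<open>1\<close>, and its columns span.\<close>

definition "sigma z j = (if j < r (prv z) then j else 0)"
definition "tau x s = (\<lambda>k i. s k (i + rep (p (prv (fst k))) (x (prv (fst k), sigma (fst k) (snd k)))))"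
definition mat :: "nat \<Rightarrow> nat \<Rightarrow> residues_ring" where "mat i j = (if i = j \<and> 0 < j then 0 else 1)"
definition "form s s' = (\<lambda>k. if k \<in> TI
  then \<Sum>j<u (fst k). mat (snd k) j * dot (p (prv (fst k))) (s (fst k, j)) (s' (fst k, j)) else 0)"

lemma prv [simp]: "prv z < n"
  using n by (simp add: zpred_less)

lemma p_neq: "z < n \<Longrightarrow> p z \<noteq> p (prv z)"
  using inj zpred_neq[OF n] prv by (metis inj_on_def lessThan_iff)

lemma p_pos [simp]: "z < n \<Longrightarrow> 0 < p z"
  using p prime_gt_0_nat by blast

lemma finite_U: "z < n \<Longrightarrow> finite (U z)"
  using finite_subset[OF U_cyc0] finite_subset[OF _ finite_cyc[of "p z" "p (prv z)"]] cyc0_subset p_pos prv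
  by (metis subsetI)

lemma U_cyc: "z < n \<Longrightarrow> v \<in> U z \<Longrightarrow> v \<in> cyc (p z) (p (prv z))"
  using U_cyc0 cyc0_subset by blast

lemma finite_SI: "finite SI" and finite_TI: "finite TI"
  by (simp_all add: SI_def TI_def)

lemma SS_in: "s \<in> SS \<Longrightarrow> z < n \<Longrightarrow> j < u z \<Longrightarrow> s (z, j) \<in> U z"
  using coord_prod_in[of s SI "\<lambda>k. U (fst k)" "(z, j)"] by (simp add: SS_def SI_def)

lemma SS_out: "s \<in> SS \<Longrightarrow> \<not> (z < n \<and> j < u z) \<Longrightarrow> s (z, j) = 0"
  using coord_prod_out[of s SI "\<lambda>k. U (fst k)" "(z, j)"] by (auto simp: SS_def SI_def)

lemma TT_in: "x \<in> TT \<Longrightarrow> z < n \<Longrightarrow> x (z, i) \<in> gf (p z)"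
  using coord_prod_in[of x TI "\<lambda>k. gf (p (fst k))" "(z, i)"] coord_prod_out[of x TI "\<lambda>k. gf (p (fst k))" "(z, i)"]
  by (cases "i < r z") (auto simp: TT_def TI_def)

lemma diff_closed_SS: "diff_closed SS"
  unfolding SS_def by (rule diff_closed_coord_prod) (auto simp: SI_def U_diff)

lemma diff_closed_gf: "diff_closed (gf q)"
  using gf_add gf_minus by (force simp: diff_closed_def simp flip: add_uminus_conv_diff)

lemma diff_closed_TT: "diff_closed TT"
  unfolding TT_def by (rule diff_closed_coord_prod) (rule diff_closed_gf)

lemma finite_SS: "finite SS" and finite_TT: "finite TT"
  unfolding SS_def TT_def by (auto intro!: finite_coord_prod finite_SI finite_TI finite_U finite_gf simp: SI_def TI_def)

lemma card_SS: "card SS = (\<Prod>z<n. card (U z) ^ u z)"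
  unfolding SS_def card_coord_prod[OF finite_SI] unfolding SI_def
  using prod.Sigma[of "{..<n}" "\<lambda>z. {..<u z}" "\<lambda>z _. card (U z)"] by (simp add: case_prod_unfold)

lemma card_TT: "card TT = (\<Prod>z<n. p z ^ r z)"
  unfolding TT_def card_coord_prod[OF finite_TI] unfolding TI_def
  using prod.Sigma[of "{..<n}" "\<lambda>z. {..<r z}" "\<lambda>z _. card (gf (p z))"]
  by (simp add: case_prod_unfold card_gf)

lemma sing_SS: "z < n \<Longrightarrow> j < u z \<Longrightarrow> v \<in> U z \<Longrightarrow> sing (z, j) v \<in> SS"
  unfolding SS_def by (rule sing_in_coord_prod) (auto simp: SI_def intro: diff_closed_0[OF U_diff])

lemma tau_apply: "tau x s (z, j) = (\<lambda>i. s (z, j) (i + rep (p (prv z)) (x (prv z, sigma z j))))"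
  by (simp add: tau_def)

lemma tau_in: "s \<in> SS \<Longrightarrow> tau x s \<in> SS"
  unfolding SS_def coord_prod_def by (auto simp: tau_def SI_def U_shift split: if_splits)

lemma form_in:
  assumes "s \<in> SS" "s' \<in> SS"
  shows "form s s' \<in> TT"
proof -
  have "mat i j * dot (p (prv z)) (s (z, j)) (s' (z, j)) \<in> gf (p z)" if "z < n" "j < u z" for z i j
    using that assms by (auto simp: mat_def intro!: dot_in_gf U_cyc SS_in)
  then show ?thesis
    unfolding TT_def coord_prod_def by (auto simp: form_def TI_def intro!: gf_sum)
qed

text \<open>A second argument supported on one copy isolates one column of
  \<open>mat\<close>.\<close>

lemma form_sing:
  assumes "j < u z"
  shows "form s (sing (z, j) w) = (\<lambda>k. if k \<in> TI \<and> fst k = z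
    then mat (snd k) j * dot (p (prv z)) (s (z, j)) w else 0)"
proof
  fix k
  show "form s (sing (z, j) w) k = (if k \<in> TI \<and> fst k = z
    then mat (snd k) j * dot (p (prv z)) (s (z, j)) w else 0)"
  proof (cases "k \<in> TI \<and> fst k = z")
    case True
    have "(\<Sum>j'<u z. mat (snd k) j' * dot (p (prv z)) (s (z, j')) (sing (z, j) w (z, j')))
        = (\<Sum>j'<u z. if j' = j then mat (snd k) j * dot (p (prv z)) (s (z, j)) w else 0)"
      by (intro sum.cong) (auto simp: sing_def)
    then show ?thesis using True assms by (simp add: form_def)
  next
    case False
    then show ?thesis by (auto simp: form_def sing_def intro!: sum.neutral)
  qed
qed


section \<open>Spreading an ideal around the cycle\<close>

lemma shift_diff_surj:
  assumes z: "z < n" and c: "\<not> int (p (prv z)) dvd c" and v: "v \<in> U z"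
  obtains w where "w \<in> U z" "v = (\<lambda>i. w i - w (i + c))"
proof -
  let ?f = "\<lambda>w i. w i - w (i + c)"
  have "?f ` U z \<subseteq> U z"
    using U_shift[OF z] diff_closed_diff[OF U_diff[OF z]] by (fastforce simp: fun_diff_def)
  \<comment> \<open>Two sequences with equal image differ by one fixed under a nontrivial shift,
    hence by zero. Finiteness turns injectivity into surjectivity.\<close>
  moreover have "inj_on ?f (U z)"
  proof (rule inj_onI)
    fix w w' assume w: "w \<in> U z" "w' \<in> U z" and eq: "?f w = ?f w'"
    have "(w - w') (i + c) = (w - w') i" for i
      using fun_cong[OF eq, of i] by (simp add: algebra_simps)
    moreover have "w - w' \<in> cyc0 (p z) (p (prv z))"
      using diff_closed_diff[OF U_diff[OF z] w] U_cyc0[OF z] by blast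
    ultimately have "w - w' = 0"
      using cyc0_shift_fixed[of "p z" "p (prv z)" "w - w'" c] p z p_neq[OF z] prv c by blast
    then show "w = w'" by simp
  qed
  ultimately have "?f ` U z = U z"
    using finite_U[OF z] endo_inj_surj by blast
  then show ?thesis using v that by (metis (no_types, lifting) imageE)
qed

text \<open>The coordinate of \<open>x\<close> that governs copy \<open>j\<close> shifts it
  nontrivially, so by \<open>shift_diff_surj\<close> every \<open>v\<close> is the difference of
  some \<open>w\<close> and its shift.\<close>

lemma full_S_step:
  assumes KT: "x \<in> KT" "KT \<subseteq> TT"
    and KS: "\<And>x s. x \<in> KT \<Longrightarrow> s \<in> SS \<Longrightarrow> s - tau x s \<in> KS"
    and z: "z < n" "j < u z" and x: "x (prv z, sigma z j) \<noteq> 0" and v: "v \<in> U z"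
  shows "sing (z, j) v \<in> KS"
proof -
  define c where "c = rep (p (prv z)) (x (prv z, sigma z j))"
  have "x (prv z, sigma z j) \<in> gf (p (prv z))"
    using KT TT_in by auto
  then have "\<not> int (p (prv z)) dvd c"
    using x by (simp add: c_def rep_eq_0_iff)
  then obtain w where w: "w \<in> U z" "v = (\<lambda>i. w i - w (i + c))"
    using shift_diff_surj[OF z(1) _ v] by blast
  have "sing (z, j) w - tau x (sing (z, j) w) = sing (z, j) v"
    by (rule ext) (auto simp: sing_def tau_def w(2) c_def fun_eq_iff)
  then show ?thesis using KS[OF KT(1) sing_SS[OF z w(1)]] by simp
qed

text \<open>These scaled columns of \<open>mat\<close> are what the form produces from a single copy
  of \<open>U z\<close>.\<close>

definition "col z j y = (\<lambda>k. if k \<in> TI \<and> fst k = z then mat (snd k) j * y else 0)"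

text \<open>Nondegeneracy gives one nonzero value \<open>y0\<close> of the dot product, and its
  integer multiples exhaust the prime field.\<close>

lemma full_T_step:
  assumes KT: "diff_closed KT"
    and b: "\<And>s s'. s \<in> KS \<Longrightarrow> s' \<in> SS \<Longrightarrow> form s s' \<in> KT"
    and z: "z < n" "j < u z" and KS: "\<And>v. v \<in> U z \<Longrightarrow> sing (z, j) v \<in> KS"
    and y: "y \<in> gf (p z)"
  shows "col z j y \<in> KT"
proof -
  obtain v where v: "v \<in> U z" "v \<noteq> 0"
    using U_nontrivial[OF z(1)] diff_closed_0[OF U_diff[OF z(1)]] by blast
  then obtain w where w: "w \<in> U z" "dot (p (prv z)) v w \<noteq> 0" using U_nondegenerate[OF z(1)] by blast
  define y0 where "y0 = dot (p (prv z)) v w"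
  have "y0 \<in> gf (p z)" unfolding y0_def using U_cyc[OF z(1)] v w by (intro dot_in_gf)
  then obtain c where c: "of_int c * y0 = idem (p z)"
    using gf_inverse[OF p[OF z(1)]] w(2) y0_def by metis
  have sing: "sing (z, j) v (z, j) = v" by (simp add: sing_def)
  have "form (sing (z, j) v) (sing (z, j) w) \<in> KT"
    by (rule b[OF KS[OF v(1)] sing_SS[OF z w(1)]])
  then have "col z j y0 \<in> KT"
    unfolding form_sing[OF z(2)] sing col_def y0_def .
  then have "(\<lambda>k. of_int (rep (p z) y * c) * col z j y0 k) \<in> KT"
    by (rule diff_closed_of_int_mult[OF KT])
  moreover have "of_int (rep (p z) y * c) * y0 = y"
    using c of_int_rep[OF y] by (simp add: mult.assoc)
  then have "(\<lambda>k. of_int (rep (p z) y * c) * col z j y0 k) = col z j y"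
    by (auto simp: col_def mult.left_commute)
  ultimately show ?thesis by simp
qed

lemma idem_p_nonzero: "z < n \<Longrightarrow> idem (p z) \<noteq> 0"
  using of_int_mult_idem_eq_0_iff[of 1 "p z"] p[of z] by (auto simp: prime_nat_iff)

lemma mat_0 [simp]: "mat 0 j = 1" "mat i 0 = 1"
  by (auto simp: mat_def)

text \<open>One step around the cycle: copy \<open>j\<close> of the previous part yields column
  \<open>j\<close> of \<open>mat\<close>, whose entry in row \<open>sigma z k\<close> moves copy
  \<open>k\<close> of part \<open>z\<close>.\<close>

lemma full_S_next:
  assumes KT: "diff_closed KT" "KT \<subseteq> TT"
    and KS: "\<And>x s. x \<in> KT \<Longrightarrow> s \<in> SS \<Longrightarrow> s - tau x s \<in> KS"
    and b: "\<And>s s'. s \<in> KS \<Longrightarrow> s' \<in> SS \<Longrightarrow> form s s' \<in> KT"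
    and z: "z < n" and j: "j < u (prv z)" "\<And>v. v \<in> U (prv z) \<Longrightarrow> sing (prv z, j) v \<in> KS"
    and k: "k < u z" "mat (sigma z k) j \<noteq> 0" and v: "v \<in> U z"
  shows "sing (z, k) v \<in> KS"
proof -
  have "col (prv z) j (idem (p (prv z))) \<in> KT"
    by (rule full_T_step[OF KT(1) b prv j]) simp_all
  moreover have "(prv z, sigma z k) \<in> TI"
    using r(1)[OF prv[of z]] by (simp add: TI_def sigma_def)
  then have "col (prv z) j (idem (p (prv z))) (prv z, sigma z k) \<noteq> 0"
    using k(2) idem_p_nonzero[OF prv] by (auto simp: col_def mat_def split: if_splits)
  ultimately show ?thesis using full_S_step[OF _ KT(2) KS z k(1) _ v] by blast
qed

lemma full_ideal:
  assumes sub: "KS \<subseteq> SS" "KT \<subseteq> TT" "diff_closed KS" "diff_closed KT" and "KT \<noteq> {0}"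
    and KS: "\<And>x s. x \<in> KT \<Longrightarrow> s \<in> SS \<Longrightarrow> s - tau x s \<in> KS"
    and b: "\<And>s s'. s \<in> KS \<Longrightarrow> s' \<in> SS \<Longrightarrow> form s s' \<in> KT"
  shows "KS = SS \<and> KT = TT"
proof -
  note S_next = full_S_next[OF sub(4,2) KS b]
  define Q where "Q z j \<longleftrightarrow> (\<forall>v\<in>U z. sing (z, j) v \<in> KS)" for z j
  define nxt where "nxt z = Suc z mod n" for z
  have nxt: "nxt z < n" "z < n \<Longrightarrow> prv (nxt z) = z" for z
    using n by (simp_all add: nxt_def zpred_Suc_mod)
  have Q_next: "Q (nxt z) k" if "z < n" "j < u z" "Q z j" "k < u (nxt z)" "mat (sigma (nxt z) k) j \<noteq> 0" for z j k
    using S_next[of "nxt z" j k] nxt that by (auto simp: Q_def)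
  have u_pos: "0 < u z" if "z < n" for z
    using r(1,2)[OF that] by linarith
  obtain x where x: "x \<in> KT" "x \<noteq> 0" using \<open>KT \<noteq> {0}\<close> diff_closed_0[OF sub(4)] by blast
  then obtain z1 i where zi: "x (z1, i) \<noteq> 0" by (auto simp: fun_eq_iff)
  have "x \<in> TT" using x sub by blast
  then have "(z1, i) \<in> TI"
    using coord_prod_out[of x TI] zi by (auto simp: TT_def)
  then have z1: "z1 < n" "i < r z1" by (auto simp: TI_def)
  \<comment> \<open>At \<open>z2\<close> only copy \<open>i\<close> is secured. Column
    \<open>i\<close> has entry 1 in row 0, which secures copy 0 at \<open>z3\<close>; column 0
    consists of ones, so from there on every copy follows.\<close>
  define z2 where "z2 = nxt z1"
  define z3 where "z3 = nxt z2"
  have i: "i < u z2" using r(3)[OF nxt(1), of z1] nxt(2)[OF z1(1)] z1 by (simp add: z2_def)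
  have "sigma z2 i = i" using nxt(2)[OF z1(1)] z1 by (simp add: sigma_def z2_def)
  then have Q2: "Q z2 i"
    unfolding Q_def using full_S_step[OF x(1) sub(2) KS, of z2 i] i nxt z1 zi by (auto simp: z2_def)
  have "sigma z 0 = 0" for z by (simp add: sigma_def)
  then have Q3: "Q z3 0"
    unfolding z3_def using u_pos nxt(1) by (intro Q_next[OF _ i Q2]) (simp_all add: z2_def)
  have all_next: "Q (nxt z) k" if "z < n" "Q z 0" "k < u (nxt z)" for z k
    using that u_pos by (intro Q_next[of z 0 k]) simp_all
  have Q0: "Q ((z3 + i) mod n) 0" for i
  proof (induction i)
    case 0
    then show ?case using Q3 n nxt(1)[of z2] by (simp add: z3_def)
  next
    case (Suc i)
    then have "Q (nxt ((z3 + i) mod n)) 0" using n nxt(1) u_pos by (intro all_next) simp_all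
    then show ?case by (simp add: nxt_def mod_Suc_eq)
  qed
  have Q0': "Q z 0" if "z < n" for z
  proof -
    \<comment> \<open>Adding \<open>n\<close> keeps the number of steps from \<open>z3\<close> to
      \<open>z\<close> nonnegative.\<close>
    have "(z3 + (z + n - z3)) mod n = z" using that nxt(1)[of z2] by (simp add: z3_def)
    then show ?thesis using Q0[of "z + n - z3"] by simp
  qed
  have Q: "Q z k" if "z < n" "k < u z" for z k
  proof -
    have "nxt (prv z) = z" using that(1) n
      by (cases z) (auto simp: nxt_def zpred_def mod_Suc)
    then show ?thesis using all_next[of "prv z" k] Q0'[OF prv] that by simp
  qed
  have "SS \<subseteq> KS"
    unfolding SS_def using Q by (intro coord_prod_subset[OF finite_SI sub(3)]) (auto simp: SI_def Q_def)
  moreover have "TT \<subseteq> KT"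
    unfolding TT_def
  proof (intro coord_prod_subset[OF finite_TI sub(4)])
    fix k y assume k: "k \<in> TI" and y: "y \<in> gf (p (fst k))"
    obtain z i where k_eq: "k = (z, i)" by fastforce
    have z: "z < n" "i < r z" using k by (auto simp: TI_def k_eq)
    have col: "col z j y \<in> KT" if "j < u z" for j
      using Q[OF z(1) that] y unfolding Q_def
      by (intro full_T_step[OF sub(4) b z(1) that]) (auto simp: k_eq)
    have *: "sing (z, j) y \<in> KT" if "0 < j" "j < r z" for j
    proof -
      \<comment> \<open>Columns 0 and \<open>j\<close> differ only in row \<open>j\<close>.\<close>
      have "sing (z, j) y = col z 0 y - col z j y"
        using that z by (auto simp: sing_def col_def mat_def TI_def fun_eq_iff)
      then show ?thesis
        using that z r(2)[OF z(1)] by (auto intro!: diff_closed_diff[OF sub(4)] col)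
    qed
    show "sing k y \<in> KT"
    proof (cases "i = 0")
      case False
      then show ?thesis using * z k_eq by simp
    next
      case True
      \<comment> \<open>Column 0 consists of ones, so removing the other unit vectors leaves the one
        in row 0.\<close>
      have "sing (z, 0) y = col z 0 y - (\<Sum>j\<in>{0<..<r z}. sing (z, j) y)"
      proof
        fix k' :: "nat \<times> nat"
        obtain z' i' where k': "k' = (z', i')" by fastforce
        have "(\<Sum>j\<in>{0<..<r z}. sing (z, j) y (z', i')) = (if z' = z \<and> i' \<in> {0<..<r z} then y else 0)"
          by (cases "z' = z") (simp_all add: sing_def)
        then show "sing (z, 0) y k' = (col z 0 y - (\<Sum>j\<in>{0<..<r z}. sing (z, j) y)) k'"
          using z by (auto simp: k' sum_fun_apply) (auto simp: sing_def col_def TI_def)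
      qed
      also have "\<dots> \<in> KT"
        using u_pos[OF z(1)] by (intro diff_closed_diff[OF sub(4)] col diff_closed_sum[OF sub(4)] *) auto
      finally show ?thesis using True k_eq by simp
    qed
  qed
  ultimately show ?thesis using sub by blast
qed

sublocale asymmetric_product SS TT tau form
proof
  show "finite SS" "finite TT" by (rule finite_SS finite_TT)+
  show "diff_closed SS" "diff_closed TT" by (rule diff_closed_SS diff_closed_TT)+
  have "0 < n" using n by simp
  have "sing (0, 0) (idem (p 0)) \<in> TT"
    unfolding TT_def using r(1)[OF \<open>0 < n\<close>] n by (intro sing_in_coord_prod) (auto simp: TI_def)
  moreover have "sing (0, 0) (idem (p 0)) \<noteq> (0 :: nat \<times> nat \<Rightarrow> residues_ring)"
    using idem_p_nonzero[OF \<open>0 < n\<close>] by (auto simp: sing_def fun_eq_iff)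
  ultimately show "TT \<noteq> {0}" by blast
  show "tau x s \<in> SS" if "s \<in> SS" for x s using that by (rule tau_in)
  show "tau x (s - s') = tau x s - tau x s'" for x s s'
    by (simp add: tau_def fun_eq_iff)
  show "tau 0 s = s" if s: "s \<in> SS" for s
  proof
    fix k :: "nat \<times> nat"
    obtain z j where k: "k = (z, j)" by fastforce
    show "tau 0 s k = s k"
    proof (cases "z < n \<and> j < u z")
      case True
      \<comment> \<open>The chosen representative of 0 need not be 0, but it is a multiple of the
        period.\<close>
      have "int (p (prv z)) dvd rep (p (prv z)) 0" by (simp add: rep_eq_0_iff)
      then show ?thesis
        unfolding k tau_apply using True s
        by (intro ext cyc_cong[OF U_cyc[of z]] SS_in) (auto simp: cong_iff_dvd_diff)
    next
      case False
      then show ?thesis using SS_out[OF s] by (simp add: k tau_apply fun_eq_iff)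
    qed
  qed
  show "tau (x + x') s = tau x (tau x' s)" if x: "x \<in> TT" "x' \<in> TT" and s: "s \<in> SS" for x x' s
  proof
    fix k :: "nat \<times> nat"
    obtain z j where k: "k = (z, j)" by fastforce
    show "tau (x + x') s k = tau x (tau x' s) k"
    proof (cases "z < n \<and> j < u z")
      case True
      have "[rep (p (prv z)) (x (prv z, sigma z j) + x' (prv z, sigma z j)) =
        rep (p (prv z)) (x (prv z, sigma z j)) + rep (p (prv z)) (x' (prv z, sigma z j))] (mod int (p (prv z)))"
        using x by (intro rep_add_cong TT_in) simp_all
      then show ?thesis
        unfolding k tau_apply using True s
        by (intro ext cyc_cong[OF U_cyc[of z]] SS_in) (auto simp: cong_iff_dvd_diff algebra_simps)
    next
      case False
      then show ?thesis using SS_out[OF s] by (simp add: k tau_apply fun_eq_iff)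
    qed
  qed
  show "form s s' \<in> TT" if "s \<in> SS" "s' \<in> SS" for s s' using that by (rule form_in)
  show "form s s' = form s' s" for s s'
    by (auto simp: form_def fun_eq_iff intro!: sum.cong arg_cong2[of _ _ _ _ "(*)"] dot_commute)
  show "form (s - s') s'' = form s s'' - form s' s''" for s s' s''
    by (simp add: form_def fun_eq_iff dot_diff_left right_diff_distrib sum_subtractf)
  show "form (tau x s) (tau x s') = form s s'" if "s \<in> SS" "s' \<in> SS" for x s s'
  proof -
    have "dot (p (prv z)) (tau x s (z, j)) (tau x s' (z, j)) = dot (p (prv z)) (s (z, j)) (s' (z, j))"
      if "z < n" "j < u z" for z j
      unfolding tau_apply using that \<open>s \<in> SS\<close> \<open>s' \<in> SS\<close>
      by (intro dot_shift[of _ _ "p z"] U_cyc SS_in) simp_all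
    then show ?thesis by (auto simp: form_def TI_def fun_eq_iff)
  qed
  show "\<exists>r\<in>SS. form s r \<noteq> 0" if s: "s \<in> SS" "s \<noteq> 0" for s
  proof -
    obtain z j where zj: "s (z, j) \<noteq> 0" using s(2) by (auto simp: fun_eq_iff)
    then have z: "z < n" "j < u z" using SS_out[OF s(1)] by auto
    obtain w where w: "w \<in> U z" "dot (p (prv z)) (s (z, j)) w \<noteq> 0"
      using U_nondegenerate[OF z(1) SS_in[OF s(1) z] zj] by blast
    \<comment> \<open>Row 0 of \<open>mat\<close> consists of ones, so coordinate 0 detects every
      copy \<open>j\<close>.\<close>
    have "form s (sing (z, j) w) (z, 0) \<noteq> 0"
      using w r(1)[OF z(1)] z by (simp add: form_sing TI_def)
    then have "form s (sing (z, j) w) \<noteq> 0" by auto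
    then show ?thesis using sing_SS[OF z w(1)] by blast
  qed
  show "KS = SS \<and> KT = TT"
    if "KS \<subseteq> SS" "KT \<subseteq> TT" "diff_closed KS" "diff_closed KT" "KT \<noteq> {0}"
      "\<And>t s. t \<in> KT \<Longrightarrow> s \<in> SS \<Longrightarrow> s - tau t s \<in> KS"
      "\<And>s r. s \<in> KS \<Longrightarrow> r \<in> SS \<Longrightarrow> form s r \<in> KT" for KS KT
    using that by (rule full_ideal)
  show "s + tau x s' = s' + tau x' s"
    if q: "Factorial_Ring.prime q" and s: "s \<in> SS" "s' \<in> SS" and x: "x \<in> TT" "x' \<in> TT"
      and tor: "((+) x ^^ q ^ e) 0 = 0" "((+) x' ^^ q ^ e) 0 = 0"
        "((+) (s + tau x s' - (s' + tau x' s)) ^^ q ^ e) 0 = 0" for q s s' x x' e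
  proof
    fix k :: "nat \<times> nat"
    obtain z j where k: "k = (z, j)" by fastforce
    let ?c = "s + tau x s' - (s' + tau x' s)"
    have cS: "?c \<in> SS"
      by (intro diff_closed_diff diff_closed_add diff_closed_SS s tau_in)
    show "(s + tau x s') k = (s' + tau x' s) k"
    proof (cases "z < n \<and> j < u z")
      case True
      show ?thesis
      proof (cases "q = p z")
        case False
        \<comment> \<open>The \<open>z\<close>-part of \<open>S\<close> has no
          \<open>q\<close>-torsion, so the torsion element \<open>?c\<close> vanishes there.\<close>
        have "?c (z, j) i = 0" for i
        proof (rule gf_prime_power_torsion[OF p q False])
          show "?c (z, j) i \<in> gf (p z)"
            using True SS_in[OF cS] U_cyc cyc_gf by blast
          have "((+) ?c ^^ q ^ e) 0 (z, j) i = 0" unfolding tor(3) by simp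
          then show "of_nat (q ^ e) * ?c (z, j) i = 0"
            unfolding funpow_add_apply2 .
        qed (use True in simp)
        then show ?thesis by (simp add: k fun_eq_iff)
      next
        case q_eq: True
        \<comment> \<open>The part of \<open>T\<close> that acts on the \<open>z\<close>-part of
          \<open>S\<close> has characteristic \<open>p (prv z)\<close>, hence no
          \<open>q\<close>-torsion, so \<open>x\<close> and \<open>x'\<close> act trivially
          here.\<close>
        have "y (prv z, i) = 0" if y: "y \<in> TT" "((+) y ^^ q ^ e) 0 = 0" for y i
        proof (rule gf_prime_power_torsion[OF p[OF prv[of z]] q])
          have "((+) y ^^ q ^ e) 0 (prv z, i) = 0" unfolding y(2) by simp
          then show "of_nat (q ^ e) * y (prv z, i) = 0"
            unfolding funpow_add_apply .
        qed (use True q_eq p_neq y TT_in in auto)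
        from this[OF x(1) tor(1)] this[OF x(2) tor(2)]
        have "tau x s' (z, j) = tau 0 s' (z, j)" "tau x' s (z, j) = tau 0 s (z, j)"
          by (simp_all add: tau_apply)
        then show ?thesis using \<open>\<And>s. s \<in> SS \<Longrightarrow> tau 0 s = s\<close> s by (simp add: k add.commute)
      qed
    next
      case False
      then show ?thesis using SS_out[OF cS, of z j] by (simp add: k)
    qed
  qed
qed

end

section \<open>Choice of the numbers of copies\<close>

lemma exponent_bound:
  fixes a a' d m :: nat
  assumes "m \<ge> max a a' * (a + 1)" "1 \<le> d" "d \<le> a"
  shows "max a a' \<le> (m - 1) div d"
proof -
  \<comment> \<open>As \<open>max a a'\<close> is at least 1, it pays for the 1 lost in
    \<open>m - 1\<close>.\<close>
  have "max a a' * d + 1 \<le> max a a' * d + max a a'" using assms by simp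
  also have "\<dots> = max a a' * (d + 1)" by simp
  also have "\<dots> \<le> max a a' * (a + 1)" using assms(3) by (intro mult_le_mono) auto
  also have "\<dots> \<le> m" by (rule assms(1))
  finally have "max a a' * d \<le> m - 1" by simp
  then show ?thesis using assms(2) by (metis less_eq_div_iff_mult_less_eq less_le_trans zero_less_one)
qed

theorem theorem4p6:
  fixes n :: nat and p m :: "nat \<Rightarrow> nat"
  assumes "n > 1"
    and "\<forall>z<n. Factorial_Ring.prime (p z)"
    and "inj_on p {..<n}"
    and "\<forall>z<n. m z \<ge>
      (let k = (\<lambda>z. ord (p (zpred n z)) (p z)) in
       if p (zpred n z) \<noteq> 2
       then max (nu (k z) * k z) (nu (k (zpred n z)) * k (zpred n z)) * (nu (k z) * k z + 1)
       else 2 * nu (k (zpred n z)) * k (zpred n z))"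
  shows "\<exists>(B :: nat set) ad mu. finite B \<and> simple_brace B ad mu \<and>
           card B = (\<Prod>z<n. p z ^ m z) \<and>
           metabelian (mul_grp B mu) \<and> sylow_abelian (mul_grp B mu)"
proof -
  define a where "a z = nu (ord (p (zpred n z)) (p z)) * ord (p (zpred n z)) (p z)" for z
  have prv: "zpred n z < n" for z using assms(1) by (simp add: zpred_less)
  have neq: "p z \<noteq> p (zpred n z)" if "z < n" for z
    using assms(1,3) zpred_neq[OF assms(1) that] prv that by (metis inj_on_def lessThan_iff)
  have m: "m z \<ge> (if p (zpred n z) \<noteq> 2 then max (a z) (a (zpred n z)) * (a z + 1) else 2 * a (zpred n z))"
    if "z < n" for z
    using assms(4)[rule_format, OF that] by (simp only: Let_def a_def mult.assoc)
  have "\<forall>z\<in>{..<n}. \<exists>W. \<exists>d. card W = p z ^ d \<and> 1 \<le> d \<and> d \<le> a z \<and> (p (zpred n z) = 2 \<longrightarrow> d = 1) \<and>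
    W \<subseteq> cyc0 (p z) (p (zpred n z)) \<and> diff_closed W \<and>
    (\<forall>v\<in>W. \<forall>c. (\<lambda>i. v (i + c)) \<in> W) \<and>
    (\<forall>v\<in>W. v \<noteq> 0 \<longrightarrow> (\<exists>w\<in>W. dot (p (zpred n z)) v w \<noteq> 0))"
  proof
    fix z assume "z \<in> {..<n}"
    then have z: "z < n" by simp
    obtain W d where W: "card W = p z ^ d" "1 \<le> d" "d \<le> a z" "p (zpred n z) = 2 \<Longrightarrow> d = 1"
      "W \<subseteq> cyc0 (p z) (p (zpred n z))" "0 \<in> W" "\<And>v w. v \<in> W \<Longrightarrow> w \<in> W \<Longrightarrow> v + w \<in> W"
      "\<And>v. v \<in> W \<Longrightarrow> - v \<in> W" "\<And>v c. v \<in> W \<Longrightarrow> (\<lambda>i. v (i + c)) \<in> W"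
      "\<And>v. v \<in> W \<Longrightarrow> v \<noteq> 0 \<Longrightarrow> \<exists>w\<in>W. (\<Sum>i<p (zpred n z). v (int i) * w (int i)) \<noteq> 0"
      unfolding a_def
      using cyclic_reversible_code[of "p z" "p (zpred n z)"] assms(2) z prv neq[OF z] by blast
    have W_diff: "diff_closed W"
      unfolding diff_closed_def
      using W(6,7,8) by (metis diff_conv_add_uminus)
    show "\<exists>W d. card W = p z ^ d \<and> 1 \<le> d \<and> d \<le> a z \<and> (p (zpred n z) = 2 \<longrightarrow> d = 1) \<and>
      W \<subseteq> cyc0 (p z) (p (zpred n z)) \<and> diff_closed W \<and>
      (\<forall>v\<in>W. \<forall>c. (\<lambda>i. v (i + c)) \<in> W) \<and>
      (\<forall>v\<in>W. v \<noteq> 0 \<longrightarrow> (\<exists>w\<in>W. dot (p (zpred n z)) v w \<noteq> 0))"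
      unfolding dot_def
      by (intro exI[of _ W] exI[of _ d] conjI ballI allI impI; (rule W W_diff; assumption))
  qed
  then obtain U d where U: "\<forall>z\<in>{..<n}. card (U z) = p z ^ d z \<and> 1 \<le> d z \<and> d z \<le> a z \<and>
    (p (zpred n z) = 2 \<longrightarrow> d z = 1) \<and>
    U z \<subseteq> cyc0 (p z) (p (zpred n z)) \<and> diff_closed (U z) \<and>
    (\<forall>v\<in>U z. \<forall>c. (\<lambda>i. v (i + c)) \<in> U z) \<and>
    (\<forall>v\<in>U z. v \<noteq> 0 \<longrightarrow> (\<exists>w\<in>U z. dot (p (zpred n z)) v w \<noteq> 0))"
    unfolding bchoice_iff by blast
  then have d: "1 \<le> d z" "d z \<le> a z" "p (zpred n z) = 2 \<Longrightarrow> d z = 1" "card (U z) = p z ^ d z" if "z < n" for z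
    using that by simp_all
  \<comment> \<open>Dividing \<open>m z - 1\<close> instead of \<open>m z\<close> puts
    \<open>r z\<close> between 1 and \<open>d z\<close>, so that no part of \<open>T\<close> is
    trivial.\<close>
  define r where "r z = Suc ((m z - 1) mod d z)" for z
  define u where "u z = (m z - 1) div d z" for z
  have r_le: "r z \<le> d z" if "z < n" for z
    using d(1)[OF that] by (simp add: r_def Suc_le_eq)
  have bound: "max (r z) (r (zpred n z)) \<le> u z" if "z < n" for z
  proof (cases "p (zpred n z) = 2")
    case False
    have "max (a z) (a (zpred n z)) \<le> u z"
      unfolding u_def using m[OF that] False d[OF that] by (intro exponent_bound) auto
    then show ?thesis
      using r_le[OF that] r_le[OF prv] d(2)[OF that] d(2)[OF prv] by (meson le_trans max.boundedE max.boundedI)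
  next
    case True
    \<comment> \<open>Here \<open>d z = 1\<close>, so \<open>r z = 1\<close> and
      \<open>u z = m z - 1\<close>; the factor 2 in the bound absorbs the lost 1.\<close>
    have "r (zpred n z) \<le> a (zpred n z)" "1 \<le> a (zpred n z)"
      using r_le[OF prv] d(1,2)[OF prv] le_trans by blast+
    moreover have "2 * a (zpred n z) \<le> m z" using m[OF that] True by simp
    ultimately show ?thesis using d(3)[OF that True] by (simp add: r_def u_def)
  qed
  have m_eq: "d z * u z + r z = m z" if "z < n" for z
  proof -
    \<comment> \<open>A positive quotient shows that the subtraction in \<open>m z - 1\<close> does
      not truncate.\<close>
    have "0 < u z" using bound[OF that] by (simp add: r_def)
    then have "m z > 0" by (cases "m z") (simp_all add: u_def)
    moreover have "d z * u z + (m z - 1) mod d z = m z - 1"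
      unfolding u_def by (rule mult_div_mod_eq)
    ultimately show ?thesis unfolding r_def by linarith
  qed
  interpret cyclic_code_family n p U u r
  proof
    show "n > 1" "inj_on p {..<n}" by fact+
    fix z assume z: "z < n"
    show "Factorial_Ring.prime (p z)" using assms(2) z by blast
    show "U z \<subseteq> cyc0 (p z) (p (zpred n z))" "diff_closed (U z)" using U z by auto
    show "(\<lambda>i. v (i + c)) \<in> U z" if "v \<in> U z" for v c using U z that by auto
    have "1 < p z ^ d z"
      using prime_gt_1_nat[of "p z"] assms(2) z d(1)[OF z] by (intro one_less_power) simp_all
    then show "U z \<noteq> {0}" using d(4)[OF z] by auto
    show "\<exists>w\<in>U z. dot (p (zpred n z)) v w \<noteq> 0" if "v \<in> U z" "v \<noteq> 0" for v using U z that by auto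
    show "0 < r z" "r z \<le> u z" "r (zpred n z) \<le> u z" using bound[OF z] by (simp_all add: r_def)
  qed
  have "card SS * card TT = (\<Prod>z<n. p z ^ m z)"
    unfolding card_SS card_TT prod.distrib[symmetric]
    by (intro prod.cong refl) (simp add: d(4) m_eq flip: power_mult power_add)
  then show ?thesis using asymmetric_product_brace by simp
qed

end
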